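(* Let $(X,\mathcal{O})$ be a ringed finite space and let $\mathcal{M}$ be an $\mathcal{O}$-module. Then $\mathcal{M}$ is quasi-coherent if and only if for any $p\leq q$ in $X$ the natural morphism $$\mathcal{M}_p\otimes_{\mathcal{O}_p}\mathcal{O}_q\to\mathcal{M}_q$$ is an isomorphism.
   Context: A ringed finite space is a ringed space $(X,\mathcal{O})$ ($\mathcal{O}$ a sheaf of commutative rings with unit) whose underlying topological space $X$ is finite. For $p\in X$, $U_p$ denotes the smallest open subset containing $p$. The preorder on $X$ is: $p\leq q$ iff $q\in U_p$ (equivalently, $p$ lies in the closure of $q$). For a sheaf $F$ on $X$, the stalk at $p$ is $F_p=F(U_p)$, and for $p\leq q$ restriction gives a map $F_p\to F_q$; in particular there are ring homomorphisms $r_{pq}\colon\mathcal{O}_p\to\mathcal{O}_q$. For an $\mathcal{O}$-module $\mathcal{M}$ the restriction $\mathcal{M}_p\to\mathcal{M}_q$ is $\mathcal{O}_p$-linear and induces the $\mathcal{O}_q$-linear morphism $\mathcal{M}_p\otimes_{\mathcal{O}_p}\mathcal{O}_q\to\mathcal{M}_q$. An $\mathcal{O}$-module $\mathcal{M}$ is quasi-coherent if each $x\in X$ has an open neighborhood $U$ with an exact sequence $\mathcal{O}_{|U}^{I}\to\mathcal{O}_{|U}^{J}\to\mathcal{M}_{|U}\to 0$ for some (arbitrary) index sets $I,J$. *)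

theory Defs
  imports "HOL-Analysis.Abstract_Topology" "HOL-Algebra.Module" "HOL-Algebra.Free_Abelian_Groups"
begin

section \<open>Sheaves of rings and of modules\<close>

text \<open>A presheaf assigns to each set \<open>U\<close> (only open \<open>U\<close> matter) an object of sections, and to
  each pair \<open>U\<close>, \<open>V\<close> (only open \<open>V \<subseteq> U\<close> matter) the restriction map from \<open>U\<close> to \<open>V\<close>. The objects
  of sections are HOL-Algebra rings, respectively modules, carried by subsets of one fixed type.\<close>

record ('x, 'a, 's) presheaf =
  sections :: "'x set \<Rightarrow> 's"
  restr :: "'x set \<Rightarrow> 'x set \<Rightarrow> 'a \<Rightarrow> 'a"

type_synonym ('x, 'r) ring_presheaf = "('x, 'r, 'r ring) presheaf"
type_synonym ('x, 'r, 'm) module_presheaf = "('x, 'm, ('r, 'm) module) presheaf"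

locale sheaf_of_sets =
  fixes X :: "'x topology" and F :: "'x set \<Rightarrow> 'a set" and \<rho> :: "'x set \<Rightarrow> 'x set \<Rightarrow> 'a \<Rightarrow> 'a"
  assumes restr_closed:
      "\<lbrakk>openin X U; openin X V; V \<subseteq> U; s \<in> F U\<rbrakk> \<Longrightarrow> \<rho> U V s \<in> F V"
    and restr_id: "\<lbrakk>openin X U; s \<in> F U\<rbrakk> \<Longrightarrow> \<rho> U U s = s"
    and restr_comp:
      "\<lbrakk>openin X U; openin X V; openin X W; W \<subseteq> V; V \<subseteq> U; s \<in> F U\<rbrakk>
        \<Longrightarrow> \<rho> V W (\<rho> U V s) = \<rho> U W s"
    and locality:
      "\<lbrakk>\<And>V. V \<in> \<V> \<Longrightarrow> openin X V; s \<in> F (\<Union>\<V>); t \<in> F (\<Union>\<V>);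
        \<And>V. V \<in> \<V> \<Longrightarrow> \<rho> (\<Union>\<V>) V s = \<rho> (\<Union>\<V>) V t\<rbrakk> \<Longrightarrow> s = t"
    and gluing:
      "\<lbrakk>\<And>V. V \<in> \<V> \<Longrightarrow> openin X V; \<And>V. V \<in> \<V> \<Longrightarrow> \<sigma> V \<in> F V;
        \<And>V W. \<lbrakk>V \<in> \<V>; W \<in> \<V>\<rbrakk> \<Longrightarrow> \<rho> V (V \<inter> W) (\<sigma> V) = \<rho> W (V \<inter> W) (\<sigma> W)\<rbrakk>
        \<Longrightarrow> \<exists>s\<in>F (\<Union>\<V>). \<forall>V\<in>\<V>. \<rho> (\<Union>\<V>) V s = \<sigma> V"

locale ringed_space =
  sheaf_of_sets X "\<lambda>U. carrier (sections \<O> U)" "restr \<O>"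
  for X :: "'x topology" and \<O> :: "('x, 'r) ring_presheaf" +
  assumes sections_cring: "openin X U \<Longrightarrow> cring (sections \<O> U)"
    and restr_ring_hom:
      "\<lbrakk>openin X U; openin X V; V \<subseteq> U\<rbrakk> \<Longrightarrow> restr \<O> U V \<in> ring_hom (sections \<O> U) (sections \<O> V)"

locale ringed_finite_space = ringed_space X \<O>
  for X :: "'x topology" and \<O> :: "('x, 'r) ring_presheaf" +
  assumes finite_topspace: "finite (topspace X)"

locale sheaf_of_modules =
  ringed_space X \<O> + M: sheaf_of_sets X "\<lambda>U. carrier (sections \<M> U)" "restr \<M>"
  for X :: "'x topology" and \<O> :: "('x, 'r) ring_presheaf"
    and \<M> :: "('x, 'r, 'm) module_presheaf" +
  assumes sections_module: "openin X U \<Longrightarrow> Module.module (sections \<O> U) (sections \<M> U)"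
    and restr_add:
      "\<lbrakk>openin X U; openin X V; V \<subseteq> U; s \<in> carrier (sections \<M> U); t \<in> carrier (sections \<M> U)\<rbrakk>
        \<Longrightarrow> restr \<M> U V (s \<oplus>\<^bsub>sections \<M> U\<^esub> t) = restr \<M> U V s \<oplus>\<^bsub>sections \<M> V\<^esub> restr \<M> U V t"
    and restr_smult:
      "\<lbrakk>openin X U; openin X V; V \<subseteq> U; a \<in> carrier (sections \<O> U); s \<in> carrier (sections \<M> U)\<rbrakk>
        \<Longrightarrow> restr \<M> U V (a \<odot>\<^bsub>sections \<M> U\<^esub> s) = restr \<O> U V a \<odot>\<^bsub>sections \<M> V\<^esub> restr \<M> U V s"


section \<open>Minimal open sets, specialization preorder, stalks\<close>

definition min_open :: "'x topology \<Rightarrow> 'x \<Rightarrow> 'x set" where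
  "min_open X p = \<Inter>{U. openin X U \<and> p \<in> U}"

lemma min_open_is_least:
  assumes "finite (topspace X)" "p \<in> topspace X"
  shows "openin X (min_open X p)" "p \<in> min_open X p"
    and "\<And>U. \<lbrakk>openin X U; p \<in> U\<rbrakk> \<Longrightarrow> min_open X p \<subseteq> U"
proof -
  have "finite {U. openin X U \<and> p \<in> U}"
    by (rule finite_subset[of _ "Pow (topspace X)"]) (use assms openin_subset in auto)
  then show "openin X (min_open X p)"
    unfolding min_open_def using assms by (intro openin_Inter) auto
qed (auto simp: min_open_def)

definition specializes :: "'x topology \<Rightarrow> 'x \<Rightarrow> 'x \<Rightarrow> bool" where
  "specializes X p q \<longleftrightarrow> q \<in> min_open X p"

text \<open>On a finite space the colimit defining the stalk at \<open>p\<close> is attained at the smallest open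
  neighbourhood of \<open>p\<close>.\<close>

definition stalk :: "'x topology \<Rightarrow> ('x, 'a, 's) presheaf \<Rightarrow> 'x \<Rightarrow> 's" where
  "stalk X F p = sections F (min_open X p)"

definition stalk_restr :: "'x topology \<Rightarrow> ('x, 'a, 's) presheaf \<Rightarrow> 'x \<Rightarrow> 'x \<Rightarrow> 'a \<Rightarrow> 'a" where
  "stalk_restr X F p q = restr F (min_open X p) (min_open X q)"


section \<open>Module homomorphisms, tensor products and base change\<close>

definition module_hom ::
    "('r, 'c) ring_scheme \<Rightarrow> ('r, 'm, 'd) module_scheme \<Rightarrow> ('r, 'n, 'e) module_scheme \<Rightarrow> ('m \<Rightarrow> 'n) set" where
  "module_hom R M N = {h \<in> carrier M \<rightarrow> carrier N.
     (\<forall>x\<in>carrier M. \<forall>y\<in>carrier M. h (x \<oplus>\<^bsub>M\<^esub> y) = h x \<oplus>\<^bsub>N\<^esub> h y) \<and>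
     (\<forall>a\<in>carrier R. \<forall>x\<in>carrier M. h (a \<odot>\<^bsub>M\<^esub> x) = a \<odot>\<^bsub>N\<^esub> h x)}"

definition module_iso ::
    "('r, 'c) ring_scheme \<Rightarrow> ('r, 'm, 'd) module_scheme \<Rightarrow> ('r, 'n, 'e) module_scheme \<Rightarrow> ('m \<Rightarrow> 'n) set" where
  "module_iso R M N = {h \<in> module_hom R M N. bij_betw h (carrier M) (carrier N)}"

text \<open>The tensor product of \<open>R\<close>-modules as an abelian group (written multiplicatively, as
  quotient groups are in HOL-Algebra): the free abelian group on pairs, modulo bilinearity.\<close>

definition tensor_relators ::
    "('r, 'c) ring_scheme \<Rightarrow> ('r, 'm, 'd) module_scheme \<Rightarrow> ('r, 'n, 'e) module_scheme
      \<Rightarrow> (('m \<times> 'n) \<Rightarrow>\<^sub>0 int) set" where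
  "tensor_relators R M N =
     {frag_of (x \<oplus>\<^bsub>M\<^esub> x', y) - frag_of (x, y) - frag_of (x', y) | x x' y.
        x \<in> carrier M \<and> x' \<in> carrier M \<and> y \<in> carrier N} \<union>
     {frag_of (x, y \<oplus>\<^bsub>N\<^esub> y') - frag_of (x, y) - frag_of (x, y') | x y y'.
        x \<in> carrier M \<and> y \<in> carrier N \<and> y' \<in> carrier N} \<union>
     {frag_of (a \<odot>\<^bsub>M\<^esub> x, y) - frag_of (x, a \<odot>\<^bsub>N\<^esub> y) | a x y.
        a \<in> carrier R \<and> x \<in> carrier M \<and> y \<in> carrier N}"

definition tensor_relations ::
    "('r, 'c) ring_scheme \<Rightarrow> ('r, 'm, 'd) module_scheme \<Rightarrow> ('r, 'n, 'e) module_scheme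
      \<Rightarrow> (('m \<times> 'n) \<Rightarrow>\<^sub>0 int) set" where
  "tensor_relations R M N =
     generate (free_Abelian_group (carrier M \<times> carrier N)) (tensor_relators R M N)"

definition tensor_group ::
    "('r, 'c) ring_scheme \<Rightarrow> ('r, 'm, 'd) module_scheme \<Rightarrow> ('r, 'n, 'e) module_scheme
      \<Rightarrow> (('m \<times> 'n) \<Rightarrow>\<^sub>0 int) set monoid" where
  "tensor_group R M N = free_Abelian_group (carrier M \<times> carrier N) Mod tensor_relations R M N"

definition pure_tensor ::
    "('r, 'c) ring_scheme \<Rightarrow> ('r, 'm, 'd) module_scheme \<Rightarrow> ('r, 'n, 'e) module_scheme
      \<Rightarrow> 'm \<Rightarrow> 'n \<Rightarrow> (('m \<times> 'n) \<Rightarrow>\<^sub>0 int) set" where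
  "pure_tensor R M N x y =
     tensor_relations R M N #>\<^bsub>free_Abelian_group (carrier M \<times> carrier N)\<^esub> frag_of (x, y)"

text \<open>The additive map on the tensor product induced by a balanced map \<open>h\<close> into (the additive
  group of) \<open>P\<close>: extend \<open>h\<close> additively to the free abelian group, on which it is then constant on
  cosets of the relations.\<close>

definition free_lift :: "('p, 'c) ring_scheme \<Rightarrow> ('k \<Rightarrow> 'p) \<Rightarrow> ('k \<Rightarrow>\<^sub>0 int) \<Rightarrow> 'p" where
  "free_lift P h u = (\<Oplus>\<^bsub>P\<^esub>k\<in>Poly_Mapping.keys u. [Poly_Mapping.lookup u k] \<cdot>\<^bsub>P\<^esub> h k)"

definition tensor_lift :: "('p, 'c) ring_scheme \<Rightarrow> ('m \<Rightarrow> 'n \<Rightarrow> 'p) \<Rightarrow> (('m \<times> 'n) \<Rightarrow>\<^sub>0 int) set \<Rightarrow> 'p" where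
  "tensor_lift P h C = the_elem (free_lift P (\<lambda>(x, y). h x y) ` C)"

text \<open>A ring \<open>S\<close> as a module over \<open>R\<close> along \<open>f\<close> from \<open>R\<close> to \<open>S\<close>.\<close>

definition ring_as_module :: "('r \<Rightarrow> 's) \<Rightarrow> 's ring \<Rightarrow> ('r, 's) module" where
  "ring_as_module f S = ring.extend S \<lparr>smult = (\<lambda>a s. f a \<otimes>\<^bsub>S\<^esub> s)\<rparr>"

text \<open>The \<open>S\<close>-module obtained by tensoring the \<open>R\<close>-module \<open>M\<close> with \<open>S\<close> over \<open>R\<close> along \<open>f\<close>; the
  scalar \<open>b\<close> acts by \<open>b (x \<otimes> s) = x \<otimes> b s\<close>. The ring fields \<open>mult\<close> and \<open>one\<close> that every
  HOL-Algebra module record has carry no meaning.\<close>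

definition base_change ::
    "'r ring \<Rightarrow> 's ring \<Rightarrow> ('r \<Rightarrow> 's) \<Rightarrow> ('r, 'm) module \<Rightarrow> ('s, (('m \<times> 's) \<Rightarrow>\<^sub>0 int) set) module" where
  "base_change R S f M =
     (let N = ring_as_module f S; T = tensor_group R M N in
      \<lparr>carrier = carrier T, mult = undefined, one = undefined,
       ring.zero = one T, ring.add = mult T,
       smult = (\<lambda>b C. tensor_relations R M N <#>\<^bsub>free_Abelian_group (carrier M \<times> carrier N)\<^esub>
                 frag_extend (\<lambda>(x, s). frag_of (x, b \<otimes>\<^bsub>S\<^esub> s)) ` C)\<rparr>)"

definition stalk_base_change ::
    "'x topology \<Rightarrow> ('x, 'r) ring_presheaf \<Rightarrow> ('x, 'r, 'm) module_presheaf \<Rightarrow> 'x \<Rightarrow> 'x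
      \<Rightarrow> ('r, (('m \<times> 'r) \<Rightarrow>\<^sub>0 int) set) module" where
  "stalk_base_change X \<O> \<M> p q =
     base_change (stalk X \<O> p) (stalk X \<O> q) (stalk_restr X \<O> p q) (stalk X \<M> p)"

definition natural_morphism ::
    "'x topology \<Rightarrow> ('x, 'r, 'm) module_presheaf \<Rightarrow> 'x \<Rightarrow> 'x \<Rightarrow> (('m \<times> 'r) \<Rightarrow>\<^sub>0 int) set \<Rightarrow> 'm" where
  "natural_morphism X \<M> p q =
     tensor_lift (stalk X \<M> q) (\<lambda>x a. a \<odot>\<^bsub>stalk X \<M> q\<^esub> stalk_restr X \<M> p q x)"

text \<open>On pure tensors the scalar multiplication and the natural morphism are given by the expected
  formulas (lemmas \<open>base_change_smult_pure_tensor\<close> and \<open>natural_morphism_pure_tensor\<close>).\<close>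

lemma free_lift_hom:
  assumes "abelian_group P" and h: "h ` S \<subseteq> carrier P"
  shows "free_lift P h \<in> hom (free_Abelian_group S) (add_monoid P)"
proof -
  interpret P: abelian_group P by fact
  have eq: "free_lift P h u = (\<Oplus>\<^bsub>P\<^esub>k\<in>A. [Poly_Mapping.lookup u k] \<cdot>\<^bsub>P\<^esub> h k)"
    if "finite A" "Poly_Mapping.keys u \<subseteq> A" "A \<subseteq> S" for u A
    unfolding free_lift_def using that h
    by (intro P.add.finprod_mono_neutral_cong_left)
      (auto simp: in_keys_iff add_pow_def image_subset_iff subset_iff
        intro!: P.add.int_pow_closed[unfolded add_pow_def])
  show ?thesis
  proof (rule homI)
    fix u assume "u \<in> carrier (free_Abelian_group S)"
    then show "free_lift P h u \<in> carrier (add_monoid P)"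
      unfolding free_lift_def using h
      by (auto intro!: P.finsum_closed P.add.int_pow_closed simp: image_subset_iff)
  next
    fix u v assume "u \<in> carrier (free_Abelian_group S)" "v \<in> carrier (free_Abelian_group S)"
    then have k: "Poly_Mapping.keys u \<subseteq> S" "Poly_Mapping.keys v \<subseteq> S" by auto
    define A where "A = Poly_Mapping.keys u \<union> Poly_Mapping.keys v"
    have A: "finite A" "Poly_Mapping.keys u \<subseteq> A" "Poly_Mapping.keys v \<subseteq> A" "A \<subseteq> S"
      "Poly_Mapping.keys (u + v) \<subseteq> A"
      using k keys_add[of u v] by (auto simp: A_def)
    have hA: "h k \<in> carrier P" if "k \<in> A" for k using that A(4) h by blast
    have "free_lift P h (u + v) =
        (\<Oplus>\<^bsub>P\<^esub>k\<in>A. [Poly_Mapping.lookup u k] \<cdot>\<^bsub>P\<^esub> h k \<oplus>\<^bsub>P\<^esub> [Poly_Mapping.lookup v k] \<cdot>\<^bsub>P\<^esub> h k)"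
      unfolding eq[OF A(1,5,4)]
      by (rule P.finsum_cong') (auto simp: lookup_add hA P.add.int_pow_mult)
    also have "\<dots> = free_lift P h u \<oplus>\<^bsub>P\<^esub> free_lift P h v"
      unfolding eq[OF A(1,2,4)] eq[OF A(1,3,4)]
      by (rule P.finsum_addf) (auto simp: hA)
    finally show "free_lift P h (u \<otimes>\<^bsub>free_Abelian_group S\<^esub> v) =
        free_lift P h u \<otimes>\<^bsub>add_monoid P\<^esub> free_lift P h v"
      by simp
  qed
qed

lemma free_lift_of:
  assumes "abelian_group P" "h k \<in> carrier P"
  shows "free_lift P h (frag_of k) = h k"
proof -
  interpret P: abelian_group P by fact
  show ?thesis using assms by (simp add: free_lift_def)
qed

lemma tensor_lift_pure_tensor:
  assumes "Module.module R M" "Module.module R N" "abelian_group P"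
    and h: "\<And>x y. \<lbrakk>x \<in> carrier M; y \<in> carrier N\<rbrakk> \<Longrightarrow> h x y \<in> carrier P"
    and h1: "\<And>x x' y. \<lbrakk>x \<in> carrier M; x' \<in> carrier M; y \<in> carrier N\<rbrakk>
      \<Longrightarrow> h (x \<oplus>\<^bsub>M\<^esub> x') y = h x y \<oplus>\<^bsub>P\<^esub> h x' y"
    and h2: "\<And>x y y'. \<lbrakk>x \<in> carrier M; y \<in> carrier N; y' \<in> carrier N\<rbrakk>
      \<Longrightarrow> h x (y \<oplus>\<^bsub>N\<^esub> y') = h x y \<oplus>\<^bsub>P\<^esub> h x y'"
    and h3: "\<And>a x y. \<lbrakk>a \<in> carrier R; x \<in> carrier M; y \<in> carrier N\<rbrakk>
      \<Longrightarrow> h (a \<odot>\<^bsub>M\<^esub> x) y = h x (a \<odot>\<^bsub>N\<^esub> y)"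
    and xy: "x \<in> carrier M" "y \<in> carrier N"
  shows "tensor_lift P h (pure_tensor R M N x y) = h x y"
proof -
  interpret M: Module.module R M by fact
  interpret N: Module.module R N by fact
  interpret P: abelian_group P by fact
  define S where "S = carrier M \<times> carrier N"
  define F where "F = free_lift P (\<lambda>(x, y). h x y)"
  interpret F: group_hom "free_Abelian_group S" "add_monoid P" F
    unfolding F_def by (intro group_hom.intro group_hom_axioms.intro free_lift_hom)
      (use h in \<open>auto simp: S_def P.a_group assms\<close>)
  have of: "F (frag_of (x, y)) = h x y" if "x \<in> carrier M" "y \<in> carrier N" for x y
    unfolding F_def using free_lift_of[OF \<open>abelian_group P\<close>, of "\<lambda>(x, y). h x y"] h that by auto
  have diff: "F (u - v) = F u \<ominus>\<^bsub>P\<^esub> F v" if "Poly_Mapping.keys u \<subseteq> S" "Poly_Mapping.keys v \<subseteq> S" for u v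
  proof -
    have "F (u + (-v)) = F u \<oplus>\<^bsub>P\<^esub> F (-v)"
      using F.hom_mult[of u "-v"] that by simp
    also have "F (-v) = \<ominus>\<^bsub>P\<^esub> F v"
      using F.hom_inv[of v] that by (simp add: a_inv_def)
    finally show ?thesis by (simp add: a_minus_def)
  qed
  have ker: "F u = \<zero>\<^bsub>P\<^esub> \<and> Poly_Mapping.keys u \<subseteq> S" if "u \<in> tensor_relators R M N" for u
  proof -
    have k: "Poly_Mapping.keys (frag_of z - frag_of w) \<subseteq> S" if "z \<in> S" "w \<in> S" for z w
      by (rule order.trans[OF keys_diff]) (use that in auto)
    have k3: "Poly_Mapping.keys (frag_of z - frag_of w - frag_of v) \<subseteq> S" if "z \<in> S" "w \<in> S" "v \<in> S" for z w v
      by (rule order.trans[OF keys_diff]) (use that k in auto)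
    have z: "(a \<oplus>\<^bsub>P\<^esub> b) \<ominus>\<^bsub>P\<^esub> a \<ominus>\<^bsub>P\<^esub> b = \<zero>\<^bsub>P\<^esub>" if "a \<in> carrier P" "b \<in> carrier P" for a b
      using that P.a_comm P.a_assoc P.r_neg by (metis P.add.inv_closed P.add.inv_solve_right' P.minus_eq P.add.m_closed)
    have zz: "a \<ominus>\<^bsub>P\<^esub> a = \<zero>\<^bsub>P\<^esub>" if "a \<in> carrier P" for a
      using that by (simp add: P.minus_eq P.r_neg)
    have Smem: "(x, y) \<in> S \<longleftrightarrow> x \<in> carrier M \<and> y \<in> carrier N" for x y by (simp add: S_def)
    from that show ?thesis
      unfolding tensor_relators_def
      by (elim UnE CollectE exE conjE)
        (simp_all add: diff k k3 Smem of h1 h2 h3 z h zz M.smult_closed N.smult_closed)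
  qed
  have "tensor_relations R M N \<subseteq> kernel (free_Abelian_group S) (add_monoid P) F"
    unfolding tensor_relations_def S_def[symmetric]
    by (rule group.generate_subgroup_incl[OF F.G.is_group _ F.subgroup_kernel])
      (use ker in \<open>auto simp: kernel_def\<close>)
  moreover have "0 \<in> tensor_relations R M N"
    using generate.one[of "free_Abelian_group S" "tensor_relators R M N"]
    by (simp add: tensor_relations_def S_def)
  moreover have fx: "Poly_Mapping.keys (frag_of (x, y)) \<subseteq> S" using xy by (simp add: S_def)
  ultimately have H: "0 \<in> tensor_relations R M N"
    "\<And>u. u \<in> tensor_relations R M N \<Longrightarrow> F (u + frag_of (x, y)) = h x y"
    using F.hom_mult[of _ "frag_of (x, y)"] h[OF xy] by (auto simp: kernel_def of[OF xy])
  have "pure_tensor R M N x y = (\<lambda>u. u + frag_of (x, y)) ` tensor_relations R M N"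
    by (auto simp: pure_tensor_def r_coset_def)
  then have "F ` pure_tensor R M N x y = {h x y}"
    using H by (force simp: image_image)
  then show ?thesis by (simp add: tensor_lift_def F_def)
qed

lemma ring_as_module_is_module:
  assumes "cring R" "cring S" "f \<in> ring_hom R S"
  shows "Module.module R (ring_as_module f S)"
proof -
  interpret S: cring S by fact
  interpret f: ring_hom_cring R S f using assms by (simp add: ring_hom_cring_def ring_hom_cring_axioms_def)
  show ?thesis
  proof (rule moduleI)
    show "abelian_group (ring_as_module f S)"
      by (rule abelian_groupI)
        (auto simp: ring_as_module_def ring.defs S.a_assoc S.a_comm S.a_lcomm intro: S.l_neg
           exI[of _ "\<ominus>\<^bsub>S\<^esub> _"] bexI[of _ "\<ominus>\<^bsub>S\<^esub> _"])
  qed (use assms(1) in \<open>auto simp: ring_as_module_def ring.defs S.l_distr S.r_distr S.m_assoc\<close>)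
qed

lemma natural_morphism_pure_tensor:
  assumes "ringed_finite_space X \<O>" "sheaf_of_modules X \<O> \<M>"
    and pq: "p \<in> topspace X" "q \<in> topspace X" "specializes X p q"
    and m: "m \<in> carrier (stalk X \<M> p)" and a: "a \<in> carrier (stalk X \<O> q)"
  shows "natural_morphism X \<M> p q
      (pure_tensor (stalk X \<O> p) (stalk X \<M> p)
        (ring_as_module (stalk_restr X \<O> p q) (stalk X \<O> q)) m a) =
    a \<odot>\<^bsub>stalk X \<M> q\<^esub> stalk_restr X \<M> p q m"
proof -
  interpret O: ringed_finite_space X \<O> by fact
  interpret M: sheaf_of_modules X \<O> \<M> by fact
  note mo = min_open_is_least[OF O.finite_topspace]
  have op: "openin X (min_open X p)" "openin X (min_open X q)" using mo pq by auto
  have sub: "min_open X q \<subseteq> min_open X p"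
    using mo(3)[OF pq(2) op(1)] pq(3) by (auto simp: specializes_def)
  interpret Mp: Module.module "stalk X \<O> p" "stalk X \<M> p"
    unfolding stalk_def by (rule M.sections_module[OF op(1)])
  interpret Mq: Module.module "stalk X \<O> q" "stalk X \<M> q"
    unfolding stalk_def by (rule M.sections_module[OF op(2)])
  have hom: "stalk_restr X \<O> p q \<in> ring_hom (stalk X \<O> p) (stalk X \<O> q)"
    unfolding stalk_def stalk_restr_def by (rule O.restr_ring_hom[OF op sub])
  have cl: "stalk_restr X \<M> p q x \<in> carrier (stalk X \<M> q)" if "x \<in> carrier (stalk X \<M> p)" for x
    using M.M.restr_closed[OF op sub] that unfolding stalk_def stalk_restr_def by auto
  show ?thesis
    unfolding natural_morphism_def
  proof (rule tensor_lift_pure_tensor[OF Mp.module_axioms ring_as_module_is_module[OF Mp.R.cring_axioms Mq.R.cring_axioms hom] Mq.abelian_group_axioms])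
  qed (use m a cl M.restr_add[OF op sub] M.restr_smult[OF op sub] ring_hom_closed[OF hom] in
     \<open>auto simp: ring_as_module_def ring.defs Mq.smult_l_distr Mq.smult_r_distr
        stalk_def[symmetric] stalk_restr_def[symmetric] Mq.smult_assoc1[symmetric] Mq.R.m_comm\<close>)
qed

lemma base_change_smult_pure_tensor:
  assumes "Module.module R M" "cring S" "f \<in> ring_hom R S"
    and x: "x \<in> carrier M" and s: "s \<in> carrier S" and b: "b \<in> carrier S"
  shows "b \<odot>\<^bsub>base_change R S f M\<^esub> pure_tensor R M (ring_as_module f S) x s =
    pure_tensor R M (ring_as_module f S) x (b \<otimes>\<^bsub>S\<^esub> s)"
proof -
  interpret M: Module.module R M by fact
  interpret S: cring S by fact
  let ?N = "ring_as_module f S"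
  let ?H = "tensor_relations R M ?N"
  let ?T = "carrier M \<times> carrier S"
  let ?F = "free_Abelian_group ?T"
  let ?g = "frag_extend (\<lambda>(x, s). frag_of (x, b \<otimes>\<^bsub>S\<^esub> s))"
  have N: "carrier ?N = carrier S" "add ?N = add S" "\<And>a s. a \<odot>\<^bsub>?N\<^esub> s = f a \<otimes>\<^bsub>S\<^esub> s"
    by (auto simp: ring_as_module_def ring.defs)
  interpret F: comm_group ?F by (rule abelian_free_Abelian_group)
  have fa: "f a \<in> carrier S" if "a \<in> carrier R" for a using ring_hom_closed[OF assms(3) that] .
  have rel: "tensor_relators R M ?N \<subseteq> carrier ?F"
    unfolding tensor_relators_def N using fa
    by (auto dest!: subsetD[OF keys_diff] split: if_splits)
  have sub: "subgroup ?H ?F"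
    unfolding tensor_relations_def N by (rule F.generate_is_subgroup[OF rel])
  have g: "group_hom ?F ?F ?g"
  proof (intro group_hom.intro group_hom_axioms.intro homI)
    fix u assume u: "u \<in> carrier ?F"
    show "?g u \<in> carrier ?F"
      using u keys_frag_extend[of "\<lambda>(x, s). frag_of (x, b \<otimes>\<^bsub>S\<^esub> s)" u] b by fastforce
  qed (auto simp: frag_extend_add F.is_group)
  then interpret g: group_hom ?F ?F ?g .
  have "?g r \<in> tensor_relators R M ?N" if "r \<in> tensor_relators R M ?N" for r
    using that unfolding tensor_relators_def N
  proof (elim UnE CollectE exE conjE, goal_cases)
    case (1 x x' y)
    with b have "b \<otimes>\<^bsub>S\<^esub> y \<in> carrier S" by simp
    with 1 show ?case by (intro UnI1) (simp add: frag_extend_diff, blast)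
  next
    case (2 x y y')
    have "b \<otimes>\<^bsub>S\<^esub> (y \<oplus>\<^bsub>S\<^esub> y') = b \<otimes>\<^bsub>S\<^esub> y \<oplus>\<^bsub>S\<^esub> b \<otimes>\<^bsub>S\<^esub> y'" using 2 b by (simp add: S.r_distr)
    with 2 b show ?case by (intro UnI1 UnI2) (auto simp: frag_extend_diff)
  next
    case (3 a x y)
    have "b \<otimes>\<^bsub>S\<^esub> (f a \<otimes>\<^bsub>S\<^esub> y) = f a \<otimes>\<^bsub>S\<^esub> (b \<otimes>\<^bsub>S\<^esub> y)" using 3 b fa by (simp add: S.m_lcomm)
    with 3 b show ?case by (intro UnI2) (auto simp: frag_extend_diff)
  qed
  then have "?g ` ?H \<subseteq> ?H"
    unfolding tensor_relations_def N g.generate_img[OF rel, symmetric]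
    by (intro F.mono_generate) auto
  moreover have "0 \<in> ?H" using subgroup.one_closed[OF sub] by simp
  moreover have "u + v \<in> ?H" if "u \<in> ?H" "v \<in> ?H" for u v
    using subgroup.m_closed[OF sub that] by simp
  ultimately have H: "{h + (?g h' + w) | h h'. h \<in> ?H \<and> h' \<in> ?H} = {h + w | h. h \<in> ?H}" for w
  proof (intro subset_antisym subsetI)
    fix z assume "z \<in> {h + (?g h' + w) | h h'. h \<in> ?H \<and> h' \<in> ?H}"
    then obtain h h' where z: "z = (h + ?g h') + w" "h \<in> ?H" "h' \<in> ?H"
      by (auto simp: add.assoc)
    have "h + ?g h' \<in> ?H"
      using \<open>?g ` ?H \<subseteq> ?H\<close> z by (intro \<open>\<And>u v. _ \<Longrightarrow> _ \<Longrightarrow> u + v \<in> ?H\<close>) auto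
    then show "z \<in> {h + w | h. h \<in> ?H}" using z by blast
  next
    fix z assume "z \<in> {h + w | h. h \<in> ?H}"
    then obtain h where "z = h + (?g 0 + w)" "h \<in> ?H" by auto
    then show "z \<in> {h + (?g h' + w) | h h'. h \<in> ?H \<and> h' \<in> ?H}" using \<open>0 \<in> ?H\<close> by blast
  qed
  have "b \<odot>\<^bsub>base_change R S f M\<^esub> pure_tensor R M ?N x s =
      {h + (?g h' + frag_of (x, b \<otimes>\<^bsub>S\<^esub> s)) | h h'. h \<in> ?H \<and> h' \<in> ?H}"
    by (auto simp: pure_tensor_def base_change_def Let_def set_mult_def r_coset_def frag_extend_add)
  also have "\<dots> = pure_tensor R M ?N x (b \<otimes>\<^bsub>S\<^esub> s)"
    unfolding H by (auto simp: pure_tensor_def r_coset_def)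
  finally show ?thesis .
qed


section \<open>Quasi-coherent modules\<close>

text \<open>All notions below are applied on an open subset \<open>U\<close> of \<open>X\<close> by using the topology
  \<open>subtopology X U\<close>; the restriction of a sheaf to \<open>U\<close> is then the same presheaf record, of which
  only the values on open subsets of \<open>U\<close> are used.\<close>

definition sheaf_hom ::
    "'x topology \<Rightarrow> ('x, 'r) ring_presheaf \<Rightarrow> ('x, 'r, 'm) module_presheaf
      \<Rightarrow> ('x, 'r, 'n) module_presheaf \<Rightarrow> ('x set \<Rightarrow> 'm \<Rightarrow> 'n) set" where
  "sheaf_hom X \<O> \<F> \<G> = {\<phi>.
     (\<forall>U. openin X U \<longrightarrow> \<phi> U \<in> module_hom (sections \<O> U) (sections \<F> U) (sections \<G> U)) \<and>
     (\<forall>U V. openin X U \<and> openin X V \<and> V \<subseteq> U \<longrightarrow>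
        (\<forall>s\<in>carrier (sections \<F> U). \<phi> V (restr \<F> U V s) = restr \<G> U V (\<phi> U s)))}"

definition sheaf_kernel ::
    "('x, 'r, 'm) module_presheaf \<Rightarrow> ('x, 'r, 'n) module_presheaf \<Rightarrow> ('x set \<Rightarrow> 'm \<Rightarrow> 'n)
      \<Rightarrow> 'x set \<Rightarrow> 'm set" where
  "sheaf_kernel \<F> \<G> \<phi> U = {s \<in> carrier (sections \<F> U). \<phi> U s = \<zero>\<^bsub>sections \<G> U\<^esub>}"

text \<open>Sections of the image sheaf are the sections that are locally in the image.\<close>

definition sheaf_image ::
    "'x topology \<Rightarrow> ('x, 'r, 'm) module_presheaf \<Rightarrow> ('x, 'r, 'n) module_presheaf
      \<Rightarrow> ('x set \<Rightarrow> 'm \<Rightarrow> 'n) \<Rightarrow> 'x set \<Rightarrow> 'n set" where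
  "sheaf_image X \<F> \<G> \<phi> U = {s \<in> carrier (sections \<G> U).
     \<forall>x\<in>U. \<exists>V. openin X V \<and> x \<in> V \<and> V \<subseteq> U \<and> restr \<G> U V s \<in> \<phi> V ` carrier (sections \<F> V)}"

text \<open>Exactness of \<open>\<F> \<rightarrow> \<G> \<rightarrow> \<H> \<rightarrow> 0\<close>.\<close>

definition right_exact_sequence ::
    "'x topology \<Rightarrow> ('x, 'r) ring_presheaf \<Rightarrow> ('x, 'r, 'l) module_presheaf
      \<Rightarrow> ('x, 'r, 'm) module_presheaf \<Rightarrow> ('x, 'r, 'n) module_presheaf
      \<Rightarrow> ('x set \<Rightarrow> 'l \<Rightarrow> 'm) \<Rightarrow> ('x set \<Rightarrow> 'm \<Rightarrow> 'n) \<Rightarrow> bool" where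
  "right_exact_sequence X \<O> \<F> \<G> \<H> \<phi> \<psi> \<longleftrightarrow>
     \<phi> \<in> sheaf_hom X \<O> \<F> \<G> \<and> \<psi> \<in> sheaf_hom X \<O> \<G> \<H> \<and>
     (\<forall>U. openin X U \<longrightarrow>
        sheaf_image X \<F> \<G> \<phi> U = sheaf_kernel \<G> \<H> \<psi> U \<and>
        sheaf_image X \<G> \<H> \<psi> U = carrier (sections \<H> U))"

definition free_module :: "'r ring \<Rightarrow> 'i set \<Rightarrow> ('r, 'i \<Rightarrow> 'r) module" where
  "free_module R I =
     \<lparr>carrier = {f \<in> I \<rightarrow>\<^sub>E carrier R. finite {i \<in> I. f i \<noteq> \<zero>\<^bsub>R\<^esub>}},
      mult = undefined, one = undefined,
      ring.zero = (\<lambda>i\<in>I. \<zero>\<^bsub>R\<^esub>), ring.add = (\<lambda>f g. \<lambda>i\<in>I. f i \<oplus>\<^bsub>R\<^esub> g i),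
      smult = (\<lambda>a f. \<lambda>i\<in>I. a \<otimes>\<^bsub>R\<^esub> f i)\<rparr>"

lemma free_module_is_module:
  assumes "cring R"
  shows "Module.module R (free_module R I)"
proof -
  interpret R: cring R by fact
  have fin_add: "finite {i \<in> I. f i \<oplus>\<^bsub>R\<^esub> g i \<noteq> \<zero>\<^bsub>R\<^esub>}"
    if "finite {i \<in> I. f i \<noteq> \<zero>\<^bsub>R\<^esub>}" "finite {i \<in> I. g i \<noteq> \<zero>\<^bsub>R\<^esub>}" for f g
    by (rule finite_subset[OF _ finite_UnI[OF that]]) auto
  have fin_smult: "finite {i \<in> I. a \<otimes>\<^bsub>R\<^esub> f i \<noteq> \<zero>\<^bsub>R\<^esub>}"
    if "finite {i \<in> I. f i \<noteq> \<zero>\<^bsub>R\<^esub>}" "a \<in> carrier R" for a f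
    by (rule finite_subset[OF _ that(1)]) (use that in auto)
  have fin_minus: "finite {i \<in> I. \<ominus>\<^bsub>R\<^esub> f i \<noteq> \<zero>\<^bsub>R\<^esub>}"
    if "finite {i \<in> I. f i \<noteq> \<zero>\<^bsub>R\<^esub>}" for f
    by (rule finite_subset[OF _ that]) auto
  have supp: "{i \<in> I. (\<lambda>i\<in>I. h i) i \<noteq> \<zero>\<^bsub>R\<^esub>} = {i \<in> I. h i \<noteq> \<zero>\<^bsub>R\<^esub>}" for h
    by auto
  show ?thesis
  proof (rule moduleI)
    show "abelian_group (free_module R I)"
    proof (rule abelian_groupI)
      fix f assume f: "f \<in> carrier (free_module R I)"
      have "(\<lambda>i\<in>I. \<ominus>\<^bsub>R\<^esub> f i) \<in> carrier (free_module R I)"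
        using f fin_minus[of f] unfolding free_module_def by (auto simp: supp cong: conj_cong)
      moreover have "(\<lambda>i\<in>I. \<ominus>\<^bsub>R\<^esub> f i) \<oplus>\<^bsub>free_module R I\<^esub> f = \<zero>\<^bsub>free_module R I\<^esub>"
        using f unfolding free_module_def by (auto simp: fun_eq_iff R.l_neg dest: PiE_mem)
      ultimately show "\<exists>g\<in>carrier (free_module R I). g \<oplus>\<^bsub>free_module R I\<^esub> f = \<zero>\<^bsub>free_module R I\<^esub>"
        by blast
    next
      fix f g assume "f \<in> carrier (free_module R I)" "g \<in> carrier (free_module R I)"
      then show "f \<oplus>\<^bsub>free_module R I\<^esub> g \<in> carrier (free_module R I)"
        using fin_add[of f g] unfolding free_module_def by (auto simp: supp cong: conj_cong)
    next
      fix f g h assume "f \<in> carrier (free_module R I)" "g \<in> carrier (free_module R I)"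
        "h \<in> carrier (free_module R I)"
      then show "(f \<oplus>\<^bsub>free_module R I\<^esub> g) \<oplus>\<^bsub>free_module R I\<^esub> h =
          f \<oplus>\<^bsub>free_module R I\<^esub> (g \<oplus>\<^bsub>free_module R I\<^esub> h)"
        unfolding free_module_def by (auto simp: fun_eq_iff R.a_assoc dest!: PiE_mem)
    next
      fix f g assume "f \<in> carrier (free_module R I)" "g \<in> carrier (free_module R I)"
      then show "f \<oplus>\<^bsub>free_module R I\<^esub> g = g \<oplus>\<^bsub>free_module R I\<^esub> f"
        unfolding free_module_def by (auto simp: fun_eq_iff R.a_comm dest!: PiE_mem)
    next
      fix f assume "f \<in> carrier (free_module R I)"
      then show "\<zero>\<^bsub>free_module R I\<^esub> \<oplus>\<^bsub>free_module R I\<^esub> f = f"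
        unfolding free_module_def by (auto simp: fun_eq_iff PiE_iff extensional_def)
    qed (auto simp: free_module_def cong: conj_cong)
  next
    fix a f assume "a \<in> carrier R" "f \<in> carrier (free_module R I)"
    then show "a \<odot>\<^bsub>free_module R I\<^esub> f \<in> carrier (free_module R I)"
      using fin_smult[of f a] unfolding free_module_def by (auto simp: supp cong: conj_cong)
  next
    fix a b f assume "a \<in> carrier R" "b \<in> carrier R" "f \<in> carrier (free_module R I)"
    then show "(a \<oplus>\<^bsub>R\<^esub> b) \<odot>\<^bsub>free_module R I\<^esub> f =
        a \<odot>\<^bsub>free_module R I\<^esub> f \<oplus>\<^bsub>free_module R I\<^esub> b \<odot>\<^bsub>free_module R I\<^esub> f"
      unfolding free_module_def by (auto simp: fun_eq_iff R.l_distr dest!: PiE_mem)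
  next
    fix a f g assume "a \<in> carrier R" "f \<in> carrier (free_module R I)" "g \<in> carrier (free_module R I)"
    then show "a \<odot>\<^bsub>free_module R I\<^esub> (f \<oplus>\<^bsub>free_module R I\<^esub> g) =
        a \<odot>\<^bsub>free_module R I\<^esub> f \<oplus>\<^bsub>free_module R I\<^esub> a \<odot>\<^bsub>free_module R I\<^esub> g"
      unfolding free_module_def by (auto simp: fun_eq_iff R.r_distr dest!: PiE_mem)
  next
    fix a b f assume "a \<in> carrier R" "b \<in> carrier R" "f \<in> carrier (free_module R I)"
    then show "(a \<otimes>\<^bsub>R\<^esub> b) \<odot>\<^bsub>free_module R I\<^esub> f =
        a \<odot>\<^bsub>free_module R I\<^esub> (b \<odot>\<^bsub>free_module R I\<^esub> f)"
      unfolding free_module_def by (auto simp: fun_eq_iff R.m_assoc dest!: PiE_mem)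
  next
    fix f assume "f \<in> carrier (free_module R I)"
    then show "\<one>\<^bsub>R\<^esub> \<odot>\<^bsub>free_module R I\<^esub> f = f"
      unfolding free_module_def by (auto simp: fun_eq_iff PiE_iff extensional_def)
  qed (rule assms)
qed

text \<open>The direct sum of copies of \<open>\<O>\<close> indexed by \<open>I\<close>, as the direct sum of presheaves. On a
  finite space this is already a sheaf (see \<open>free_sheaf_is_sheaf\<close> below), so that it is the direct
  sum in the category of sheaves of modules.\<close>

definition free_sheaf :: "('x, 'r) ring_presheaf \<Rightarrow> 'i set \<Rightarrow> ('x, 'r, 'i \<Rightarrow> 'r) module_presheaf" where
  "free_sheaf \<O> I =
     \<lparr>sections = (\<lambda>U. free_module (sections \<O> U) I),
      restr = (\<lambda>U V f. \<lambda>i\<in>I. restr \<O> U V (f i))\<rparr>"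

lemma free_sheaf_is_sheaf:
  assumes "ringed_finite_space X \<O>"
  shows "sheaf_of_modules X \<O> (free_sheaf \<O> I)"
proof -
  interpret ringed_finite_space X \<O> by fact
  let ?F = "\<lambda>U. carrier (sections (free_sheaf \<O> I) U)"
  have mem: "f \<in> ?F U \<longleftrightarrow> f \<in> I \<rightarrow>\<^sub>E carrier (sections \<O> U) \<and>
      finite {i \<in> I. f i \<noteq> \<zero>\<^bsub>sections \<O> U\<^esub>}" for f U
    by (simp add: free_sheaf_def free_module_def)
  have zero: "restr \<O> U V \<zero>\<^bsub>sections \<O> U\<^esub> = \<zero>\<^bsub>sections \<O> V\<^esub>"
    if "openin X U" "openin X V" "V \<subseteq> U" for U V
    using ring_hom_zero[OF restr_ring_hom[OF that]] sections_cring[OF that(1)]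
      sections_cring[OF that(2)] by (simp add: cring.axioms(1))
  have r: "restr (free_sheaf \<O> I) U V f = (\<lambda>i\<in>I. restr \<O> U V (f i))" for U V f
    by (simp add: free_sheaf_def)
  have ring: "ring (sections \<O> U)" if "openin X U" for U
    using sections_cring[OF that] by (rule cring.axioms(1))
  have closed: "restr (free_sheaf \<O> I) U V s \<in> ?F V"
    if "openin X U" "openin X V" "V \<subseteq> U" "s \<in> ?F U" for U V s
  proof -
    have "finite {i \<in> I. restr (free_sheaf \<O> I) U V s i \<noteq> \<zero>\<^bsub>sections \<O> V\<^esub>}"
      by (rule finite_subset[of _ "{i \<in> I. s i \<noteq> \<zero>\<^bsub>sections \<O> U\<^esub>}"])
        (use that zero[OF that(1-3)] in \<open>auto simp: mem r\<close>)
    then show ?thesis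
      using that by (auto simp: mem r PiE_iff intro!: restr_closed[OF that(1-3)])
  qed
  show ?thesis
  proof (intro sheaf_of_modules.intro sheaf_of_modules_axioms.intro sheaf_of_sets.intro)
    show "ringed_space X \<O>" by unfold_locales
    show "restr (free_sheaf \<O> I) U V s \<in> ?F V"
      if "openin X U" "openin X V" "V \<subseteq> U" "s \<in> ?F U" for U V s
      by (rule closed[OF that])
    show "restr (free_sheaf \<O> I) U U s = s" if "openin X U" "s \<in> ?F U" for U s
      using that by (auto simp: mem r fun_eq_iff restr_id PiE_iff extensional_def)
    show "restr (free_sheaf \<O> I) V W (restr (free_sheaf \<O> I) U V s) = restr (free_sheaf \<O> I) U W s"
      if "openin X U" "openin X V" "openin X W" "W \<subseteq> V" "V \<subseteq> U" "s \<in> ?F U" for U V W s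
      using that(6) restr_comp[OF that(1-5)] by (auto simp: mem r fun_eq_iff PiE_iff)
    show "s = t"
      if "\<And>V. V \<in> \<V> \<Longrightarrow> openin X V" "s \<in> ?F (\<Union>\<V>)" "t \<in> ?F (\<Union>\<V>)"
        "\<And>V. V \<in> \<V> \<Longrightarrow> restr (free_sheaf \<O> I) (\<Union>\<V>) V s = restr (free_sheaf \<O> I) (\<Union>\<V>) V t"
      for \<V> s t
    proof (rule PiE_ext[of s I "\<lambda>_. carrier (sections \<O> (\<Union>\<V>))" t])
      fix i assume i: "i \<in> I"
      have eq: "restr \<O> (\<Union>\<V>) V (s i) = restr \<O> (\<Union>\<V>) V (t i)" if "V \<in> \<V>" for V
        using fun_cong[OF \<open>\<And>V. V \<in> \<V> \<Longrightarrow> restr (free_sheaf \<O> I) (\<Union>\<V>) V s = _ V\<close>[OF that], of i] i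
        by (simp add: r)
      show "s i = t i"
        by (rule locality[OF that(1)]) (use that(2,3) i eq in \<open>auto simp: mem\<close>)
    qed (use that in \<open>auto simp: mem\<close>)
    show "\<exists>s\<in>?F (\<Union>\<V>). \<forall>V\<in>\<V>. restr (free_sheaf \<O> I) (\<Union>\<V>) V s = \<sigma> V"
      if op: "\<And>V. V \<in> \<V> \<Longrightarrow> openin X V" and \<sigma>: "\<And>V. V \<in> \<V> \<Longrightarrow> \<sigma> V \<in> ?F V"
        and comp: "\<And>V W. \<lbrakk>V \<in> \<V>; W \<in> \<V>\<rbrakk> \<Longrightarrow> restr (free_sheaf \<O> I) V (V \<inter> W) (\<sigma> V)
          = restr (free_sheaf \<O> I) W (V \<inter> W) (\<sigma> W)"
      for \<V> \<sigma>
    proof -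
      have opU: "openin X (\<Union>\<V>)" using op by blast
      have "\<exists>c\<in>carrier (sections \<O> (\<Union>\<V>)). \<forall>V\<in>\<V>. restr \<O> (\<Union>\<V>) V c = \<sigma> V i" if i: "i \<in> I" for i
      proof (rule gluing[OF op])
        show "\<sigma> V i \<in> carrier (sections \<O> V)" if "V \<in> \<V>" for V
          using \<sigma>[OF that] i by (auto simp: mem)
        show "restr \<O> V (V \<inter> W) (\<sigma> V i) = restr \<O> W (V \<inter> W) (\<sigma> W i)" if "V \<in> \<V>" "W \<in> \<V>" for V W
          using fun_cong[OF comp[OF that], of i] i by (simp add: r)
      qed
      then obtain c where c: "\<And>i. i \<in> I \<Longrightarrow> c i \<in> carrier (sections \<O> (\<Union>\<V>))"
        "\<And>i V. \<lbrakk>i \<in> I; V \<in> \<V>\<rbrakk> \<Longrightarrow> restr \<O> (\<Union>\<V>) V (c i) = \<sigma> V i"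
        by metis
      have c0: "c i = \<zero>\<^bsub>sections \<O> (\<Union>\<V>)\<^esub>"
        if i: "i \<in> I" and "\<And>V. V \<in> \<V> \<Longrightarrow> \<sigma> V i = \<zero>\<^bsub>sections \<O> V\<^esub>" for i
      proof (rule locality[OF op])
        show "\<zero>\<^bsub>sections \<O> (\<Union>\<V>)\<^esub> \<in> carrier (sections \<O> (\<Union>\<V>))"
          using ring[OF opU] by (simp add: ring.ring_simprules)
        show "restr \<O> (\<Union>\<V>) V (c i) = restr \<O> (\<Union>\<V>) V \<zero>\<^bsub>sections \<O> (\<Union>\<V>)\<^esub>" if "V \<in> \<V>" for V
          using zero[OF opU op[OF that] Union_upper[OF that]] c(2)[OF i that] \<open>\<And>V. V \<in> \<V> \<Longrightarrow> \<sigma> V i = _ V\<close>[OF that]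
          by simp
      qed (use c i in auto)
      have "finite \<V>"
        by (rule finite_subset[of _ "Pow (topspace X)"])
          (use op openin_subset finite_topspace in auto)
      then have "finite (\<Union>V\<in>\<V>. {i \<in> I. \<sigma> V i \<noteq> \<zero>\<^bsub>sections \<O> V\<^esub>})"
        using \<sigma> by (auto simp: mem)
      moreover have "{i \<in> I. (\<lambda>i\<in>I. c i) i \<noteq> \<zero>\<^bsub>sections \<O> (\<Union>\<V>)\<^esub>} \<subseteq>
          (\<Union>V\<in>\<V>. {i \<in> I. \<sigma> V i \<noteq> \<zero>\<^bsub>sections \<O> V\<^esub>})"
        by (auto intro: c0)
      ultimately have "(\<lambda>i\<in>I. c i) \<in> ?F (\<Union>\<V>)"
        using c(1) by (auto simp: mem intro: finite_subset cong: conj_cong)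
      moreover have "restr (free_sheaf \<O> I) (\<Union>\<V>) V (\<lambda>i\<in>I. c i) = \<sigma> V" if "V \<in> \<V>" for V
        using \<sigma>[OF that] c(2)[OF _ that] by (auto simp: mem r fun_eq_iff PiE_iff extensional_def)
      ultimately show ?thesis by blast
    qed
    show "Module.module (sections \<O> U) (sections (free_sheaf \<O> I) U)" if "openin X U" for U
      using free_module_is_module[OF sections_cring[OF that]] by (simp add: free_sheaf_def)
    show "restr (free_sheaf \<O> I) U V (s \<oplus>\<^bsub>sections (free_sheaf \<O> I) U\<^esub> t) =
        restr (free_sheaf \<O> I) U V s \<oplus>\<^bsub>sections (free_sheaf \<O> I) V\<^esub> restr (free_sheaf \<O> I) U V t"
      if "openin X U" "openin X V" "V \<subseteq> U" "s \<in> ?F U" "t \<in> ?F U" for U V s t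
      using that(4,5) ring_hom_add[OF restr_ring_hom[OF that(1-3)]]
      by (auto simp: free_sheaf_def free_module_def fun_eq_iff PiE_iff)
    show "restr (free_sheaf \<O> I) U V (a \<odot>\<^bsub>sections (free_sheaf \<O> I) U\<^esub> s) =
        restr \<O> U V a \<odot>\<^bsub>sections (free_sheaf \<O> I) V\<^esub> restr (free_sheaf \<O> I) U V s"
      if "openin X U" "openin X V" "V \<subseteq> U" "a \<in> carrier (sections \<O> U)" "s \<in> ?F U" for U V a s
      using that(4,5) ring_hom_mult[OF restr_ring_hom[OF that(1-3)]]
      by (auto simp: free_sheaf_def free_module_def fun_eq_iff PiE_iff)
  qed
qed

text \<open>The two type arguments are the types in which the index sets \<open>I\<close> and \<open>J\<close> of the local
  presentations range. Arbitrary index sets are captured by taking these types of the form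
  \<open>'i + ('m \<Rightarrow> 'r)\<close> and \<open>'j + 'm\<close> with \<open>'i\<close> and \<open>'j\<close> free: these contain every prescribed
  type, and always have room for all sections of \<open>\<M>\<close> over a given open set as generators and
  all relations between them.\<close>

definition quasi_coherent ::
    "'i itself \<Rightarrow> 'j itself \<Rightarrow> 'x topology \<Rightarrow> ('x, 'r) ring_presheaf
      \<Rightarrow> ('x, 'r, 'm) module_presheaf \<Rightarrow> bool" where
  "quasi_coherent TYPE('i) TYPE('j) X \<O> \<M> \<longleftrightarrow>
     (\<forall>x\<in>topspace X. \<exists>U. openin X U \<and> x \<in> U \<and>
        (\<exists>(I :: 'i set) (J :: 'j set) \<phi> \<psi>.
           right_exact_sequence (subtopology X U) \<O> (free_sheaf \<O> I) (free_sheaf \<O> J) \<M> \<phi> \<psi>))"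

end

theory Submission
  imports Defs
begin

text \<open>Over a finite space, sections over the minimal open set of a point are the stalk there, and a
  sequence of sheaves is exact iff it is exact on these stalks. So quasi-coherence says that every
  point has an open neighbourhood \<open>U\<close> with maps \<open>\<O>\<^sup>I \<rightarrow> \<O>\<^sup>J \<rightarrow> \<M>\<close> over \<open>U\<close> that are right exact on the
  stalk at each point of \<open>U\<close>. Base change is right exact and carries \<open>\<O>\<^sub>p\<^sup>I \<rightarrow> \<O>\<^sub>p\<^sup>J\<close> to
  \<open>\<O>\<^sub>q\<^sup>I \<rightarrow> \<O>\<^sub>q\<^sup>J\<close>; hence, if the sequence is exact at \<open>p\<close>, the natural morphism for \<open>p \<le> q\<close> is an
  isomorphism iff the sequence is exact at \<open>q\<close>. For the converse, the presentation of \<open>\<M>\<^sub>p\<close> by all its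
  elements and all relations between them spreads to the minimal open set of \<open>p\<close> by restriction.\<close>

section \<open>Semilinear maps and free modules\<close>

text \<open>The equivalence at points \<open>p\<close>, \<open>q\<close> comes from one
  identification. Let \<open>R\<close>, \<open>S\<close> be the ring stalks at \<open>p\<close> and
  \<open>q\<close> and \<open>M\<close> the module stalk at \<open>p\<close>. A presentation of
  \<open>M\<close> by \<open>\<phi>\<close>, \<open>\<psi>\<close> gives an isomorphism from the
  cokernel of the map \<open>\<phi>'\<close> over \<open>S\<close> to the tensor product of
  \<open>M\<close> and \<open>S\<close>, under which the natural morphism becomes the map induced by
  \<open>\<psi>'\<close>. That map is bijective exactly when the row over \<open>S\<close> is right
  exact. Since the tensor product is a concrete quotient of a free abelian group, the isomorphism is
  written on representatives in both directions, and equations become congruences modulo the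
  relations or modulo the image of \<open>\<phi>'\<close>. The inverse chooses preimages under
  \<open>\<psi>\<close>, a choice that is linear only modulo that image; hence maps out of the free
  abelian group are treated as bilinear up to a subgroup. For the converse, every \<open>q\<close>
  in the minimal open set of \<open>p\<close> satisfies \<open>p \<le> q\<close>, so the hypothesis
  reaches all stalks over the neighbourhood on which the presentation is spread out.\<close>

definition semilinear :: "('r, 'c) ring_scheme \<Rightarrow> ('r \<Rightarrow> 's) \<Rightarrow> ('r, 'm, 'd) module_scheme
    \<Rightarrow> ('s, 'n, 'e) module_scheme \<Rightarrow> ('m \<Rightarrow> 'n) set" where
  "semilinear R f M N = {h \<in> carrier M \<rightarrow> carrier N.
     (\<forall>x\<in>carrier M. \<forall>y\<in>carrier M. h (x \<oplus>\<^bsub>M\<^esub> y) = h x \<oplus>\<^bsub>N\<^esub> h y) \<and>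
     (\<forall>a\<in>carrier R. \<forall>x\<in>carrier M. h (a \<odot>\<^bsub>M\<^esub> x) = f a \<odot>\<^bsub>N\<^esub> h x)}"

text \<open>Restriction maps relate modules over different rings and are linear only along
  \<open>f\<close>. Through this equation the facts about semilinear maps serve for ordinary
  homomorphisms too.\<close>

lemma module_hom_eq_semilinear: "module_hom R M N = semilinear R (\<lambda>a. a) M N"
  by (simp add: module_hom_def semilinear_def)

lemma semilinearD:
  assumes "h \<in> semilinear R f M N"
  shows "x \<in> carrier M \<Longrightarrow> h x \<in> carrier N"
    and "\<lbrakk>x \<in> carrier M; y \<in> carrier M\<rbrakk> \<Longrightarrow> h (x \<oplus>\<^bsub>M\<^esub> y) = h x \<oplus>\<^bsub>N\<^esub> h y"
    and "\<lbrakk>a \<in> carrier R; x \<in> carrier M\<rbrakk> \<Longrightarrow> h (a \<odot>\<^bsub>M\<^esub> x) = f a \<odot>\<^bsub>N\<^esub> h x"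
  using assms by (auto simp: semilinear_def)

lemma module_homD:
  assumes "h \<in> module_hom R M N"
  shows "x \<in> carrier M \<Longrightarrow> h x \<in> carrier N"
    and "\<lbrakk>x \<in> carrier M; y \<in> carrier M\<rbrakk> \<Longrightarrow> h (x \<oplus>\<^bsub>M\<^esub> y) = h x \<oplus>\<^bsub>N\<^esub> h y"
    and "\<lbrakk>a \<in> carrier R; x \<in> carrier M\<rbrakk> \<Longrightarrow> h (a \<odot>\<^bsub>M\<^esub> x) = a \<odot>\<^bsub>N\<^esub> h x"
  using assms by (auto simp: module_hom_def)

lemma semilinear_comp:
  assumes "h \<in> semilinear R f M N" "g \<in> semilinear S f' N P" "f ` carrier R \<subseteq> carrier S"
  shows "(\<lambda>x. g (h x)) \<in> semilinear R (\<lambda>a. f' (f a)) M P"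
  using assms by (auto simp: semilinear_def Pi_def image_subset_iff)

lemma semilinear_add_hom:
  assumes "abelian_group M" "abelian_group N" "h \<in> semilinear R f M N"
  shows "group_hom (add_monoid M) (add_monoid N) h"
  using assms by (auto simp: group_hom_def group_hom_axioms_def hom_def semilinear_def abelian_group.a_group)

lemma semilinear_zero:
  assumes "abelian_group M" "abelian_group N" "h \<in> semilinear R f M N"
  shows "h \<zero>\<^bsub>M\<^esub> = \<zero>\<^bsub>N\<^esub>"
  using group_hom.hom_one[OF semilinear_add_hom[OF assms]] by simp

lemma semilinear_uminus:
  assumes "abelian_group M" "abelian_group N" "h \<in> semilinear R f M N" "x \<in> carrier M"
  shows "h (\<ominus>\<^bsub>M\<^esub> x) = \<ominus>\<^bsub>N\<^esub> h x"
  using group_hom.hom_inv[OF semilinear_add_hom[OF assms(1-3)], of x] assms(4) by (simp add: a_inv_def)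

lemma semilinear_minus:
  assumes "abelian_group M" "abelian_group N" "h \<in> semilinear R f M N"
    "x \<in> carrier M" "y \<in> carrier M"
  shows "h (x \<ominus>\<^bsub>M\<^esub> y) = h x \<ominus>\<^bsub>N\<^esub> h y"
  using assms abelian_group.a_inv_closed[OF assms(1)]
  by (simp add: a_minus_def semilinearD(2)[OF assms(3)] semilinear_uminus[OF assms(1-3)])

lemma carrier_free_module:
  "f \<in> carrier (free_module R I) \<longleftrightarrow> f \<in> I \<rightarrow>\<^sub>E carrier R \<and> finite {i \<in> I. f i \<noteq> \<zero>\<^bsub>R\<^esub>}"
  by (simp add: free_module_def)

lemma free_module_ops [simp]:
  "\<zero>\<^bsub>free_module R I\<^esub> = (\<lambda>i\<in>I. \<zero>\<^bsub>R\<^esub>)"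
  "f \<oplus>\<^bsub>free_module R I\<^esub> g = (\<lambda>i\<in>I. f i \<oplus>\<^bsub>R\<^esub> g i)"
  "a \<odot>\<^bsub>free_module R I\<^esub> f = (\<lambda>i\<in>I. a \<otimes>\<^bsub>R\<^esub> f i)"
  by (simp_all add: free_module_def)

definition unit_vec :: "'r ring \<Rightarrow> 'i set \<Rightarrow> 'i \<Rightarrow> 'i \<Rightarrow> 'r" where
  "unit_vec R I i = (\<lambda>j\<in>I. if j = i then \<one>\<^bsub>R\<^esub> else \<zero>\<^bsub>R\<^esub>)"

lemma unit_vec_closed:
  assumes "cring R"
  shows "unit_vec R I i \<in> carrier (free_module R I)"
proof -
  interpret cring R by fact
  have "finite {j \<in> I. unit_vec R I i j \<noteq> \<zero>\<^bsub>R\<^esub>}"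
    by (rule finite_subset[of _ "{i}"]) (auto simp: unit_vec_def)
  then show ?thesis by (auto simp: carrier_free_module unit_vec_def)
qed

text \<open>Setting one coordinate \<open>k\<close> to zero splits off \<open>f k\<close> times a
  unit vector, so induction runs over a finite set containing the support. Additive facts then need
  checking only on multiples of unit vectors.\<close>

lemma free_module_induct [consumes 2, case_names zero single add]:
  assumes "cring R" and f: "f \<in> carrier (free_module R I)"
    and 0: "P \<zero>\<^bsub>free_module R I\<^esub>"
    and single: "\<And>a i. \<lbrakk>a \<in> carrier R; i \<in> I\<rbrakk> \<Longrightarrow> P (a \<odot>\<^bsub>free_module R I\<^esub> unit_vec R I i)"
    and add: "\<And>g h. \<lbrakk>g \<in> carrier (free_module R I); h \<in> carrier (free_module R I); P g; P h\<rbrakk>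
      \<Longrightarrow> P (g \<oplus>\<^bsub>free_module R I\<^esub> h)"
  shows "P f"
proof -
  interpret cring R by fact
  interpret F: Module.module R "free_module R I" by (rule free_module_is_module) fact
  have "P f" if "finite A" "f \<in> carrier (free_module R I)" "{i \<in> I. f i \<noteq> \<zero>\<^bsub>R\<^esub>} \<subseteq> A" for A f
    using that
  proof (induction A arbitrary: f rule: finite_induct)
    case empty
    then have "f = \<zero>\<^bsub>free_module R I\<^esub>"
      by (auto simp: carrier_free_module fun_eq_iff PiE_iff extensional_def)
    then show ?case using 0 by (simp only:)
  next
    case (insert k A)
    show ?case
    proof (cases "k \<in> I")
      case True
      define g where "g = (\<lambda>i\<in>I. if i = k then \<zero>\<^bsub>R\<^esub> else f i)"
      have fI: "f i \<in> carrier R" if "i \<in> I" for i using insert.prems(1) that by (auto simp: carrier_free_module)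
      have "finite {i \<in> I. g i \<noteq> \<zero>\<^bsub>R\<^esub>}"
        by (rule finite_subset[OF _ insert.hyps(1)]) (use insert.prems(2) in \<open>auto simp: g_def\<close>)
      then have g: "g \<in> carrier (free_module R I)"
        by (auto simp: carrier_free_module g_def fI)
      have "P g" by (rule insert.IH[OF g]) (use insert.prems(2) in \<open>auto simp: g_def\<close>)
      moreover have "f = g \<oplus>\<^bsub>free_module R I\<^esub> f k \<odot>\<^bsub>free_module R I\<^esub> unit_vec R I k"
        using insert.prems(1) fI fI[OF True]
        by (auto simp: fun_eq_iff g_def unit_vec_def carrier_free_module PiE_iff extensional_def)
      ultimately show ?thesis
        using add[OF g _ _ single[OF fI[OF True] True]] F.smult_closed[OF fI[OF True] unit_vec_closed] assms(1)
        by metis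
    next
      case False
      then show ?thesis using insert by blast
    qed
  qed
  then show ?thesis using f by (auto simp: carrier_free_module)
qed

lemma semilinear_eqI:
  assumes "cring R" "abelian_group N"
    and g: "g \<in> semilinear R f (free_module R I) N" and h: "h \<in> semilinear R f (free_module R I) N"
    and eq: "\<And>i. i \<in> I \<Longrightarrow> g (unit_vec R I i) = h (unit_vec R I i)"
    and x: "x \<in> carrier (free_module R I)"
  shows "g x = h x"
proof -
  interpret F: Module.module R "free_module R I" by (rule free_module_is_module) fact
  note z = semilinear_zero[OF F.abelian_group_axioms assms(2)]
  show ?thesis using assms(1) x
  proof (induction rule: free_module_induct)
    case zero show ?case using z[OF g] z[OF h] by (simp del: free_module_ops)
  next
    case (single a i)
    then show ?case
      using semilinearD(3)[OF g, of a] semilinearD(3)[OF h, of a] eq unit_vec_closed[OF assms(1), of I]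
      by (simp del: free_module_ops)
  next
    case (add x y)
    then show ?case using semilinearD(2)[OF g] semilinearD(2)[OF h] by (simp del: free_module_ops)
  qed
qed

text \<open>\<open>I\<close> may be infinite with only finitely many nonzero terms.
  \<open>gfinprod\<close> ranges over the nontrivial terms, whereas \<open>finsum\<close> over an
  infinite set is zero by convention.\<close>

definition lincomb :: "('r, 'm, 'd) module_scheme \<Rightarrow> 'i set \<Rightarrow> ('i \<Rightarrow> 'm) \<Rightarrow> ('i \<Rightarrow> 'r) \<Rightarrow> 'm" where
  "lincomb M I m f = gfinprod (add_monoid M) (\<lambda>i. f i \<odot>\<^bsub>M\<^esub> m i) I"

lemma lincomb_hom:
  assumes "Module.module R M" and m: "m ` I \<subseteq> carrier M"
  shows "lincomb M I m \<in> module_hom R (free_module R I) M"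
proof -
  interpret Module.module R M by fact
  have mI: "m i \<in> carrier M" if "i \<in> I" for i using m that by blast
  have fin: "finite {i \<in> I. f i \<odot>\<^bsub>M\<^esub> m i \<noteq> \<zero>\<^bsub>M\<^esub>}" and pi: "(\<lambda>i. f i \<odot>\<^bsub>M\<^esub> m i) \<in> I \<rightarrow> carrier M"
    if "f \<in> carrier (free_module R I)" for f
  proof -
    from that have "finite {i \<in> I. f i \<noteq> \<zero>\<^bsub>R\<^esub>}" by (auto simp: carrier_free_module)
    then show "finite {i \<in> I. f i \<odot>\<^bsub>M\<^esub> m i \<noteq> \<zero>\<^bsub>M\<^esub>}"
      by (rule rev_finite_subset) (auto simp: mI)
    show "(\<lambda>i. f i \<odot>\<^bsub>M\<^esub> m i) \<in> I \<rightarrow> carrier M" using that mI by (auto simp: carrier_free_module)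
  qed
  have closed: "lincomb M I m f \<in> carrier M" if "f \<in> carrier (free_module R I)" for f
    unfolding lincomb_def using M.add.gfinprod_closed[OF pi[OF that]] by simp
  have additive: "lincomb M I m (f \<oplus>\<^bsub>free_module R I\<^esub> g) = lincomb M I m f \<oplus>\<^bsub>M\<^esub> lincomb M I m g"
    if f: "f \<in> carrier (free_module R I)" and g: "g \<in> carrier (free_module R I)" for f g
  proof -
    have "lincomb M I m (f \<oplus>\<^bsub>free_module R I\<^esub> g) =
        gfinprod (add_monoid M) (\<lambda>i. f i \<odot>\<^bsub>M\<^esub> m i \<oplus>\<^bsub>M\<^esub> g i \<odot>\<^bsub>M\<^esub> m i) I"
      unfolding lincomb_def using f g
      by (intro M.add.gfinprod_cong) (auto simp: mI carrier_free_module PiE_iff simp_implies_def smult_l_distr)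
    also have "\<dots> = lincomb M I m f \<oplus>\<^bsub>M\<^esub> lincomb M I m g"
      unfolding lincomb_def using fin[OF f] fin[OF g] pi[OF f] pi[OF g] by (rule M.add.gfinprod_distrib)
    finally show ?thesis .
  qed
  have homog: "lincomb M I m (a \<odot>\<^bsub>free_module R I\<^esub> f) = a \<odot>\<^bsub>M\<^esub> lincomb M I m f"
    if a: "a \<in> carrier R" and f: "f \<in> carrier (free_module R I)" for a f
  proof -
    have fI: "f i \<in> carrier R" if "i \<in> I" for i using f that by (auto simp: carrier_free_module)
    \<comment> \<open>The support of \<open>f\<close> contains that of its multiple by
      \<open>a\<close>. Both combinations thus become sums over the same finite set, where scalars
      distribute.\<close>
    define A where "A = {i \<in> I. f i \<noteq> \<zero>\<^bsub>R\<^esub>}"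
    have A: "finite A" "A \<subseteq> I" using f by (auto simp: carrier_free_module A_def)
    have eq: "gfinprod (add_monoid M) h I = finsum M h A"
      if "\<And>i. i \<in> I \<Longrightarrow> h i \<in> carrier M" "\<And>i. i \<in> I - A \<Longrightarrow> h i = \<zero>\<^bsub>M\<^esub>" for h
    proof -
      have "h \<in> I \<rightarrow> carrier M" "h \<in> A \<rightarrow> carrier M" using that(1) A(2) by auto
      then show ?thesis
        using M.add.gfinprod_mono_neutral_cong_right[of A I h h] M.add.gfinprod_eq_finprod[of A h] that(2) A
        by (simp add: finsum_def)
    qed
    have "lincomb M I m (a \<odot>\<^bsub>free_module R I\<^esub> f) = (\<Oplus>\<^bsub>M\<^esub>i\<in>A. (a \<odot>\<^bsub>free_module R I\<^esub> f) i \<odot>\<^bsub>M\<^esub> m i)"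
      unfolding lincomb_def by (rule eq) (use a in \<open>auto simp: fI mI A_def\<close>)
    also have "\<dots> = (\<Oplus>\<^bsub>M\<^esub>i\<in>A. a \<odot>\<^bsub>M\<^esub> (f i \<odot>\<^bsub>M\<^esub> m i))"
      using a A by (intro M.finsum_cong') (auto simp: fI mI smult_assoc1 subset_iff)
    also have "\<dots> = a \<odot>\<^bsub>M\<^esub> (\<Oplus>\<^bsub>M\<^esub>i\<in>A. f i \<odot>\<^bsub>M\<^esub> m i)"
      using a A by (intro finsum_smult_ldistr[symmetric]) (auto simp: fI mI subset_iff)
    also have "\<dots> = a \<odot>\<^bsub>M\<^esub> lincomb M I m f"
      unfolding lincomb_def by (subst eq) (auto simp: fI mI A_def)
    finally show ?thesis .
  qed
  show ?thesis using closed additive homog by (simp add: module_hom_def del: free_module_ops)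
qed

lemma lincomb_unit_vec:
  assumes "Module.module R M" and m: "m ` I \<subseteq> carrier M" and i: "i \<in> I"
  shows "lincomb M I m (unit_vec R I i) = m i"
proof -
  interpret Module.module R M by fact
  have mI: "m i \<in> carrier M" if "i \<in> I" for i using m that by blast
  have "lincomb M I m (unit_vec R I i) = gfinprod (add_monoid M) m {i}"
    unfolding lincomb_def
    by (rule M.add.gfinprod_mono_neutral_cong_right) (use i in \<open>auto simp: mI unit_vec_def\<close>)
  then show ?thesis using mI[OF i] by simp
qed

definition map_vec :: "('r \<Rightarrow> 's) \<Rightarrow> 'i set \<Rightarrow> ('i \<Rightarrow> 'r) \<Rightarrow> 'i \<Rightarrow> 's" where
  "map_vec f I g = (\<lambda>i\<in>I. f (g i))"

lemma map_vec_semilinear: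
  assumes "cring R" "cring S" "f \<in> ring_hom R S"
  shows "map_vec f I \<in> semilinear R f (free_module R I) (free_module S I)"
proof -
  have z: "f \<zero>\<^bsub>R\<^esub> = \<zero>\<^bsub>S\<^esub>" using ring_hom_zero[OF assms(3)] assms(1,2) by (simp add: cring.axioms(1))
  have "finite {i \<in> I. f (g i) \<noteq> \<zero>\<^bsub>S\<^esub>}" if "finite {i \<in> I. g i \<noteq> \<zero>\<^bsub>R\<^esub>}" for g
    by (rule finite_subset[OF _ that]) (use z in auto)
  then show ?thesis
    using ring_hom_closed[OF assms(3)] ring_hom_add[OF assms(3)] ring_hom_mult[OF assms(3)]
    by (auto simp: map_vec_def semilinear_def carrier_free_module PiE_iff fun_eq_iff cong: conj_cong)
qed

lemma map_vec_unit_vec: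
  assumes "cring R" "cring S" "f \<in> ring_hom R S"
  shows "map_vec f I (unit_vec R I i) = unit_vec S I i"
  using ring_hom_zero[OF assms(3)] ring_hom_one[OF assms(3)] assms(1,2)
  by (auto simp: map_vec_def unit_vec_def fun_eq_iff cring.axioms(1))

section \<open>Base change of a presentation\<close>

text \<open>The preimage of \<open>B\<close> under the additive extension is a subgroup, so it
  contains all relations once it contains the relators. Taking \<open>B\<close> trivial gives the
  usual factorization through the tensor product; a larger \<open>B\<close> admits maps that depend
  on choices.\<close>

lemma free_lift_tensor_relations:
  fixes M :: "('r, 'm, 'd) module_scheme" and N :: "('r, 'n, 'e) module_scheme"
  assumes "Module.module R M" "Module.module R N" "abelian_group P" "subgroup B (add_monoid P)"
    and h: "\<And>x y. \<lbrakk>x \<in> carrier M; y \<in> carrier N\<rbrakk> \<Longrightarrow> h x y \<in> carrier P"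
    and h1: "\<And>x x' y. \<lbrakk>x \<in> carrier M; x' \<in> carrier M; y \<in> carrier N\<rbrakk>
      \<Longrightarrow> h (x \<oplus>\<^bsub>M\<^esub> x') y \<ominus>\<^bsub>P\<^esub> h x y \<ominus>\<^bsub>P\<^esub> h x' y \<in> B"
    and h2: "\<And>x y y'. \<lbrakk>x \<in> carrier M; y \<in> carrier N; y' \<in> carrier N\<rbrakk>
      \<Longrightarrow> h x (y \<oplus>\<^bsub>N\<^esub> y') \<ominus>\<^bsub>P\<^esub> h x y \<ominus>\<^bsub>P\<^esub> h x y' \<in> B"
    and h3: "\<And>a x y. \<lbrakk>a \<in> carrier R; x \<in> carrier M; y \<in> carrier N\<rbrakk>
      \<Longrightarrow> h (a \<odot>\<^bsub>M\<^esub> x) y \<ominus>\<^bsub>P\<^esub> h x (a \<odot>\<^bsub>N\<^esub> y) \<in> B"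
    and u: "u \<in> tensor_relations R M N"
  shows "free_lift P (\<lambda>(x, y). h x y) u \<in> B"
proof -
  interpret M: Module.module R M by fact
  interpret N: Module.module R N by fact
  interpret P: abelian_group P by fact
  define S where "S = carrier M \<times> carrier N"
  define F where "F = free_lift P (\<lambda>(x, y). h x y)"
  have hom: "F \<in> hom (free_Abelian_group S) (add_monoid P)"
    unfolding F_def by (intro free_lift_hom) (use h in \<open>auto simp: S_def assms\<close>)
  interpret F: group_hom "free_Abelian_group S" "add_monoid P" F
    by (intro group_hom.intro group_hom_axioms.intro hom) (auto simp: P.a_group)
  have of: "F (frag_of (x, y)) = h x y" if "x \<in> carrier M" "y \<in> carrier N" for x y
    unfolding F_def using free_lift_of[OF \<open>abelian_group P\<close>, of "\<lambda>(x, y). h x y"] h that by auto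
  have diff: "F (u - v) = F u \<ominus>\<^bsub>P\<^esub> F v" if "Poly_Mapping.keys u \<subseteq> S" "Poly_Mapping.keys v \<subseteq> S" for u v
    using F.hom_mult[of u "-v"] F.hom_inv[of v] that by (simp add: a_minus_def a_inv_def)
  have k: "Poly_Mapping.keys (u - v) \<subseteq> S" if "Poly_Mapping.keys u \<subseteq> S" "Poly_Mapping.keys v \<subseteq> S"
    for u v :: "('m \<times> 'n) \<Rightarrow>\<^sub>0 int"
    by (rule order.trans[OF keys_diff]) (use that in auto)
  have S: "(x, y) \<in> S \<longleftrightarrow> x \<in> carrier M \<and> y \<in> carrier N" for x y by (simp add: S_def)
  have "subgroup {u \<in> carrier (free_Abelian_group S). F u \<in> B} (free_Abelian_group S)"
  proof (rule F.G.subgroupI)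
    show "{u \<in> carrier (free_Abelian_group S). F u \<in> B} \<noteq> {}"
      using F.hom_one subgroup.one_closed[OF assms(4)] by (intro ex_in_conv[THEN iffD1] exI[of _ 0]) auto
  qed (use subgroup.m_closed[OF assms(4)] subgroup.m_inv_closed[OF assms(4)] F.hom_mult F.hom_inv
        keys_add in \<open>auto dest!: subsetD[OF keys_add]\<close>)
  moreover have "tensor_relators R M N \<subseteq> {u \<in> carrier (free_Abelian_group S). F u \<in> B}"
  proof
    fix u assume "u \<in> tensor_relators R M N"
    then show "u \<in> {u \<in> carrier (free_Abelian_group S). F u \<in> B}"
      unfolding tensor_relators_def
      by (elim UnE CollectE exE conjE) (simp_all add: diff k S of h1 h2 h3)
  qed
  ultimately have "tensor_relations R M N \<subseteq> {u \<in> carrier (free_Abelian_group S). F u \<in> B}"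
    unfolding tensor_relations_def S_def[symmetric]
    by (intro F.G.generate_subgroup_incl)
  then show ?thesis using u by (auto simp: F_def)
qed

text \<open>In the application \<open>M\<close> and \<open>N\<close> are the stalks at
  \<open>p \<le> q\<close> and \<open>\<rho>\<close> is the restriction. The tensor product is
  \<open>F\<close> modulo \<open>H\<close>, and \<open>L\<close> is the natural morphism before
  passing to cosets.\<close>

locale base_change_map =
  fixes R :: "'r ring" and S :: "'s ring" and f :: "'r \<Rightarrow> 's"
    and M :: "('r, 'm) module" and N :: "('s, 'n) module" and \<rho> :: "'m \<Rightarrow> 'n"
  assumes module_M: "Module.module R M" and module_N: "Module.module S N"
    and ring_hom: "f \<in> ring_hom R S" and semilinear: "\<rho> \<in> semilinear R f M N"
begin

sublocale M: Module.module R M by (rule module_M)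
sublocale N: Module.module S N by (rule module_N)

abbreviation "T \<equiv> ring_as_module f S"
abbreviation "F \<equiv> free_Abelian_group (carrier M \<times> carrier S)"
abbreviation "H \<equiv> tensor_relations R M T"
abbreviation "L \<equiv> free_lift N (\<lambda>(x, s). s \<odot>\<^bsub>N\<^esub> \<rho> x)"

lemma f_closed [simp]: "a \<in> carrier R \<Longrightarrow> f a \<in> carrier S"
  using ring_hom_closed[OF ring_hom] .

lemma \<rho>_closed [simp]: "x \<in> carrier M \<Longrightarrow> \<rho> x \<in> carrier N"
  using semilinearD(1)[OF semilinear] .

lemma module_T: "Module.module R T"
  by (rule ring_as_module_is_module[OF M.R.cring_axioms N.R.cring_axioms ring_hom])

lemma T_simps [simp]:
  "carrier T = carrier S" "x \<oplus>\<^bsub>T\<^esub> y = x \<oplus>\<^bsub>S\<^esub> y" "a \<odot>\<^bsub>T\<^esub> s = f a \<otimes>\<^bsub>S\<^esub> s"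
  by (auto simp: ring_as_module_def ring.defs)

lemma relators_subset: "tensor_relators R M T \<subseteq> carrier F"
  unfolding tensor_relators_def by (auto dest!: subsetD[OF keys_diff] split: if_splits)

lemma subgroup_H: "subgroup H F"
  unfolding tensor_relations_def T_simps
  by (rule group.generate_is_subgroup[OF _ relators_subset]) simp

lemma H_closed:
  "u \<in> H \<Longrightarrow> Poly_Mapping.keys u \<subseteq> carrier M \<times> carrier S" "0 \<in> H"
  "\<lbrakk>u \<in> H; v \<in> H\<rbrakk> \<Longrightarrow> u + v \<in> H" "u \<in> H \<Longrightarrow> - u \<in> H"
  "\<lbrakk>u \<in> H; v \<in> H\<rbrakk> \<Longrightarrow> u - v \<in> H"
proof -
  show keys: "Poly_Mapping.keys u \<subseteq> carrier M \<times> carrier S" if "u \<in> H" for u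
    using subgroup.subset[OF subgroup_H, THEN subsetD, OF that] by simp
  show "0 \<in> H" using subgroup.one_closed[OF subgroup_H] by simp
  show add: "u + v \<in> H" if "u \<in> H" "v \<in> H" for u v
    using subgroup.m_closed[OF subgroup_H that] by simp
  show minus: "- u \<in> H" if "u \<in> H" for u
    using subgroup.m_inv_closed[OF subgroup_H that] keys[OF that] by simp
  show "u - v \<in> H" if "u \<in> H" "v \<in> H" for u v
    using add[OF that(1) minus[OF that(2)]] by simp
qed

lemma H_sum: "(\<And>i. i \<in> A \<Longrightarrow> t i \<in> H) \<Longrightarrow> sum t A \<in> H"
  by (induction A rule: infinite_finite_induct) (auto simp: H_closed)

lemma tensor_add_left:
  "\<lbrakk>x \<in> carrier M; x' \<in> carrier M; s \<in> carrier S\<rbrakk>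
    \<Longrightarrow> frag_of (x \<oplus>\<^bsub>M\<^esub> x', s) - frag_of (x, s) - frag_of (x', s) \<in> H"
  unfolding tensor_relations_def by (rule generate.incl) (auto simp: tensor_relators_def)

lemma tensor_add_right:
  "\<lbrakk>x \<in> carrier M; s \<in> carrier S; s' \<in> carrier S\<rbrakk>
    \<Longrightarrow> frag_of (x, s \<oplus>\<^bsub>S\<^esub> s') - frag_of (x, s) - frag_of (x, s') \<in> H"
  unfolding tensor_relations_def by (rule generate.incl) (force simp: tensor_relators_def)

lemma tensor_smult:
  "\<lbrakk>a \<in> carrier R; x \<in> carrier M; s \<in> carrier S\<rbrakk>
    \<Longrightarrow> frag_of (a \<odot>\<^bsub>M\<^esub> x, s) - frag_of (x, f a \<otimes>\<^bsub>S\<^esub> s) \<in> H"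
  unfolding tensor_relations_def by (rule generate.incl) (force simp: tensor_relators_def)

text \<open>The additivity relator taken at two zeros is the negative of this generator.\<close>

lemma tensor_zero_left: "s \<in> carrier S \<Longrightarrow> frag_of (\<zero>\<^bsub>M\<^esub>, s) \<in> H"
  using tensor_add_left[of "\<zero>\<^bsub>M\<^esub>" "\<zero>\<^bsub>M\<^esub>" s] H_closed(4) by fastforce

lemma tensor_zero_right: "x \<in> carrier M \<Longrightarrow> frag_of (x, \<zero>\<^bsub>S\<^esub>) \<in> H"
  using tensor_add_right[of x "\<zero>\<^bsub>S\<^esub>" "\<zero>\<^bsub>S\<^esub>"] H_closed(4) by fastforce

lemma L_hom: "group_hom F (add_monoid N) L"
  by (intro group_hom.intro group_hom_axioms.intro free_lift_hom)
    (auto simp: N.a_group N.abelian_group_axioms)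

lemma L_frag_of [simp]:
  "\<lbrakk>x \<in> carrier M; s \<in> carrier S\<rbrakk> \<Longrightarrow> L (frag_of (x, s)) = s \<odot>\<^bsub>N\<^esub> \<rho> x"
  using free_lift_of[OF N.abelian_group_axioms, of "\<lambda>(x, s). s \<odot>\<^bsub>N\<^esub> \<rho> x" "(x, s)"] by simp

lemma L_simps:
  assumes "Poly_Mapping.keys u \<subseteq> carrier M \<times> carrier S"
  shows "L u \<in> carrier N"
    and "Poly_Mapping.keys v \<subseteq> carrier M \<times> carrier S \<Longrightarrow> L (u + v) = L u \<oplus>\<^bsub>N\<^esub> L v"
    and "Poly_Mapping.keys v \<subseteq> carrier M \<times> carrier S \<Longrightarrow> L (u - v) = L u \<ominus>\<^bsub>N\<^esub> L v"
proof -
  interpret group_hom F "add_monoid N" L by (rule L_hom)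
  show "L u \<in> carrier N" using hom_closed[of u] assms by auto
  assume "Poly_Mapping.keys v \<subseteq> carrier M \<times> carrier S"
  then show "L (u + v) = L u \<oplus>\<^bsub>N\<^esub> L v" "L (u - v) = L u \<ominus>\<^bsub>N\<^esub> L v"
    using hom_mult[of u v] hom_mult[of u "-v"] hom_inv[of v] assms
    by (auto simp: a_minus_def a_inv_def)
qed

text \<open>Balancedness is the only law that uses more than additivity: semilinearity turns
  \<open>\<rho> (a \<odot> x)\<close> into \<open>f a \<odot> \<rho> x\<close>, and commutativity of
  \<open>S\<close> lets \<open>f a\<close> join the scalar.\<close>

lemma L_relations: "u \<in> H \<Longrightarrow> L u = \<zero>\<^bsub>N\<^esub>"
proof -
  assume u: "u \<in> H"
  have sub: "subgroup {\<zero>\<^bsub>N\<^esub>} (add_monoid N)"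
    using group.triv_subgroup[OF N.a_group] by simp
  have z: "a \<oplus>\<^bsub>N\<^esub> b \<ominus>\<^bsub>N\<^esub> a \<ominus>\<^bsub>N\<^esub> b = \<zero>\<^bsub>N\<^esub>" if "a \<in> carrier N" "b \<in> carrier N" for a b
  proof -
    have "a \<oplus>\<^bsub>N\<^esub> b \<ominus>\<^bsub>N\<^esub> a \<ominus>\<^bsub>N\<^esub> b = (a \<oplus>\<^bsub>N\<^esub> b) \<oplus>\<^bsub>N\<^esub> \<ominus>\<^bsub>N\<^esub> (a \<oplus>\<^bsub>N\<^esub> b)"
      using that by (simp add: a_minus_def N.minus_add N.a_assoc)
    then show ?thesis using that by (simp add: N.r_neg)
  qed
  have zz: "a \<ominus>\<^bsub>N\<^esub> a = \<zero>\<^bsub>N\<^esub>" if "a \<in> carrier N" for a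
    using that by (simp add: N.r_neg a_minus_def)
  have "L u \<in> {\<zero>\<^bsub>N\<^esub>}"
    by (rule free_lift_tensor_relations[OF module_M module_T N.abelian_group_axioms sub _ _ _ _ u])
      (simp_all add: semilinearD[OF semilinear] N.smult_l_distr N.smult_r_distr z zz
        N.R.m_comm N.smult_assoc1[symmetric])
  then show ?thesis by simp
qed

text \<open>The scalar action on the tensor product is defined on representatives by this
  \<open>frag_extend\<close>. The claim about keys is carried through the induction because
  \<open>L\<close> is known to be additive only on elements of \<open>F\<close>.\<close>

lemma L_smult:
  assumes "Poly_Mapping.keys u \<subseteq> carrier M \<times> carrier S" "b \<in> carrier S"
  shows "Poly_Mapping.keys (frag_extend (\<lambda>(x, s). frag_of (x, b \<otimes>\<^bsub>S\<^esub> s)) u) \<subseteq> carrier M \<times> carrier S \<and>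
    L (frag_extend (\<lambda>(x, s). frag_of (x, b \<otimes>\<^bsub>S\<^esub> s)) u) = b \<odot>\<^bsub>N\<^esub> L u"
proof (rule free_Abelian_group_induct[OF assms(1)], goal_cases)
  case 1
  show ?case using L_relations[OF H_closed(2)] assms(2) by simp
next
  case (2 u v)
  let ?g = "frag_extend (\<lambda>(x, s). frag_of (x, b \<otimes>\<^bsub>S\<^esub> s))"
  have "Poly_Mapping.keys (?g u - ?g v) \<subseteq> carrier M \<times> carrier S"
    using 2 keys_diff[of "?g u" "?g v"] by blast
  then show ?case
    using 2 assms(2) L_simps(3)[of "?g u" "?g v"] L_simps[of u] L_simps(1)[of v]
    by (simp add: frag_extend_diff N.smult_r_distr a_minus_def N.smult_r_minus)
next
  case (3 z)
  then show ?case using assms(2) by (auto simp: N.smult_assoc1)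
qed

lemma tensor_lift_coset:
  assumes "Poly_Mapping.keys u \<subseteq> carrier M \<times> carrier S"
  shows "tensor_lift N (\<lambda>x s. s \<odot>\<^bsub>N\<^esub> \<rho> x) (H #>\<^bsub>F\<^esub> u) = L u"
proof -
  have "L ` (H #>\<^bsub>F\<^esub> u) = {L u}"
    using H_closed(1,2) L_relations L_simps(2)[OF _ assms] L_simps(1)[OF assms]
    by (force simp: r_coset_def)
  then show ?thesis by (simp add: tensor_lift_def)
qed

lemma coset_eq_iff:
  assumes "Poly_Mapping.keys u \<subseteq> carrier M \<times> carrier S" "Poly_Mapping.keys v \<subseteq> carrier M \<times> carrier S"
  shows "H #>\<^bsub>F\<^esub> u = H #>\<^bsub>F\<^esub> v \<longleftrightarrow> u - v \<in> H"
proof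
  assume "H #>\<^bsub>F\<^esub> u = H #>\<^bsub>F\<^esub> v"
  moreover have "u \<in> H #>\<^bsub>F\<^esub> u" using H_closed(2) by (force simp: r_coset_def)
  ultimately show "u - v \<in> H" by (auto simp: r_coset_def)
next
  assume uv: "u - v \<in> H"
  have "h + u = (h + (u - v)) + v" "h + v = (h - (u - v)) + u" for h by simp_all
  with uv show "H #>\<^bsub>F\<^esub> u = H #>\<^bsub>F\<^esub> v"
    unfolding r_coset_def mult_free_Abelian_group by (blast intro: H_closed(3,5))
qed

text \<open>On the coset of \<open>u\<close> the lift takes the value \<open>L u\<close>. So its
  image is that of \<open>L\<close>, and injectivity on cosets says that \<open>L\<close> separates
  elements of \<open>F\<close> up to \<open>H\<close>, which is a condition on the kernel.\<close>

lemma tensor_lift_iso_iff: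
  "tensor_lift N (\<lambda>x s. s \<odot>\<^bsub>N\<^esub> \<rho> x) \<in> module_iso S (base_change R S f M) N \<longleftrightarrow>
    L ` carrier F = carrier N \<and> (\<forall>u\<in>carrier F. L u = \<zero>\<^bsub>N\<^esub> \<longrightarrow> u \<in> H)"
  (is "?\<nu> \<in> _ \<longleftrightarrow> _")
proof -
  let ?B = "base_change R S f M"
  have carrier: "carrier ?B = (\<lambda>u. H #>\<^bsub>F\<^esub> u) ` carrier F"
    by (simp add: base_change_def Let_def tensor_group_def carrier_FactGroup)
  have F: "u \<in> carrier F \<longleftrightarrow> Poly_Mapping.keys u \<subseteq> carrier M \<times> carrier S" for u by simp
  have normal: "H \<lhd> F"
    using comm_group.subgroup_imp_normal[OF abelian_free_Abelian_group subgroup_H] .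
  have keys_add: "Poly_Mapping.keys (u + v) \<subseteq> carrier M \<times> carrier S"
    if "Poly_Mapping.keys u \<subseteq> carrier M \<times> carrier S" "Poly_Mapping.keys v \<subseteq> carrier M \<times> carrier S"
    for u v :: "('m \<times> 's) \<Rightarrow>\<^sub>0 int"
    using that keys_add[of u v] by blast
  have keys_diff: "Poly_Mapping.keys (u - v) \<subseteq> carrier M \<times> carrier S"
    if "Poly_Mapping.keys u \<subseteq> carrier M \<times> carrier S" "Poly_Mapping.keys v \<subseteq> carrier M \<times> carrier S"
    for u v :: "('m \<times> 's) \<Rightarrow>\<^sub>0 int"
    using that keys_diff[of u v] by blast
  have hom: "?\<nu> \<in> module_hom S ?B N"
    unfolding module_hom_def
  proof (intro CollectI conjI ballI funcsetI)
    fix C assume "C \<in> carrier ?B"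
    then show "?\<nu> C \<in> carrier N" unfolding carrier by (auto simp: tensor_lift_coset intro: L_simps(1))
  next
    fix C D assume "C \<in> carrier ?B" "D \<in> carrier ?B"
    then obtain u v where uv: "C = H #>\<^bsub>F\<^esub> u" "u \<in> carrier F" "D = H #>\<^bsub>F\<^esub> v" "v \<in> carrier F"
      unfolding carrier by blast
    have "C \<oplus>\<^bsub>?B\<^esub> D = H #>\<^bsub>F\<^esub> (u + v)"
      using normal.rcos_sum[OF normal uv(2,4)]
      by (simp add: base_change_def Let_def tensor_group_def uv)
    then show "?\<nu> (C \<oplus>\<^bsub>?B\<^esub> D) = ?\<nu> C \<oplus>\<^bsub>N\<^esub> ?\<nu> D"
      using uv keys_add by (simp add: tensor_lift_coset L_simps)
  next
    fix b C assume b: "b \<in> carrier S" and "C \<in> carrier ?B"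
    then obtain u where u: "C = H #>\<^bsub>F\<^esub> u" "u \<in> carrier F" unfolding carrier by blast
    let ?g = "frag_extend (\<lambda>(x, s). frag_of (x, b \<otimes>\<^bsub>S\<^esub> s))"
    \<comment> \<open>The action of \<open>b\<close> on a coset is defined as a set of sums, with
      one relation added before and one after the scalar map. As \<open>L\<close> kills both, it is
      constant on that set and \<open>the_elem\<close> returns this value.\<close>
    have "L (h + ?g (h' + u)) = b \<odot>\<^bsub>N\<^esub> L u" if "h \<in> H" "h' \<in> H" for h h'
    proof -
      have "L (h' + u) = L u" "Poly_Mapping.keys (h' + u) \<subseteq> carrier M \<times> carrier S"
        using L_simps(2)[of h' u] L_simps(1)[of u] H_closed(1)[OF that(2)] L_relations[OF that(2)] u(2) keys_add
        by auto
      then show ?thesis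
        using L_smult[OF _ b, of "h' + u"] L_simps(2)[OF H_closed(1)[OF that(1)], of "?g (h' + u)"]
          L_relations[OF that(1)] L_simps(1)[of u] u(2) b by simp
    qed
    moreover have "0 \<in> H" by (rule H_closed)
    ultimately have "L ` (b \<odot>\<^bsub>?B\<^esub> C) = {b \<odot>\<^bsub>N\<^esub> L u}"
      by (force simp: base_change_def Let_def set_mult_def r_coset_def u(1))
    then have "?\<nu> (b \<odot>\<^bsub>?B\<^esub> C) = b \<odot>\<^bsub>N\<^esub> L u" by (simp add: tensor_lift_def)
    then show "?\<nu> (b \<odot>\<^bsub>?B\<^esub> C) = b \<odot>\<^bsub>N\<^esub> ?\<nu> C"
      using u by (simp add: tensor_lift_coset)
  qed
  have image: "?\<nu> ` carrier ?B = L ` carrier F"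
    unfolding carrier by (force simp: tensor_lift_coset image_image)
  have "inj_on ?\<nu> (carrier ?B) \<longleftrightarrow> (\<forall>u\<in>carrier F. \<forall>v\<in>carrier F. L u = L v \<longrightarrow> u - v \<in> H)"
    unfolding carrier inj_on_def by (auto simp: tensor_lift_coset coset_eq_iff)
  also have "\<dots> \<longleftrightarrow> (\<forall>u\<in>carrier F. L u = \<zero>\<^bsub>N\<^esub> \<longrightarrow> u \<in> H)"
  proof (intro iffI ballI impI)
    fix u assume "\<forall>u\<in>carrier F. \<forall>v\<in>carrier F. L u = L v \<longrightarrow> u - v \<in> H" "u \<in> carrier F" "L u = \<zero>\<^bsub>N\<^esub>"
    then show "u \<in> H" using L_relations[OF H_closed(2)] by (metis diff_zero F keys_zero empty_subsetI)
  next
    fix u v assume "\<forall>u\<in>carrier F. L u = \<zero>\<^bsub>N\<^esub> \<longrightarrow> u \<in> H" "u \<in> carrier F" "v \<in> carrier F" "L u = L v"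
    then show "u - v \<in> H"
      using L_simps(2,3)[of u v] L_simps(1)[of v] keys_diff[of u v] by (simp add: a_minus_def N.r_neg)
  qed
  finally show ?thesis using hom image by (auto simp: module_iso_def bij_betw_def)
qed

end

section \<open>Congruence modulo a subgroup of an abelian group\<close>

context abelian_group
begin

lemma subgroup_cong_trans:
  assumes "subgroup B (add_monoid G)" "x \<in> carrier G" "y \<in> carrier G" "z \<in> carrier G"
    "x \<ominus> y \<in> B" "y \<ominus> z \<in> B"
  shows "x \<ominus> z \<in> B"
proof -
  have "(x \<ominus> y) \<oplus> (y \<ominus> z) = x \<oplus> ((\<ominus> y \<oplus> y) \<oplus> \<ominus> z)"
    using assms(2-4) by (simp only: a_minus_def a_assoc a_closed a_inv_closed)
  then have "(x \<ominus> y) \<oplus> (y \<ominus> z) = x \<ominus> z"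
    using assms(2-4) by (simp add: l_neg a_minus_def)
  then show ?thesis using subgroup.m_closed[OF assms(1,5,6)] by simp
qed

lemma subgroup_cong_add:
  assumes "subgroup B (add_monoid G)" "x \<in> carrier G" "y \<in> carrier G" "x' \<in> carrier G" "y' \<in> carrier G"
    "x \<ominus> y \<in> B" "x' \<ominus> y' \<in> B"
  shows "(x \<oplus> x') \<ominus> (y \<oplus> y') \<in> B"
proof -
  have "(x \<ominus> y) \<oplus> (x' \<ominus> y') = (x \<oplus> x') \<ominus> (y \<oplus> y')"
    using assms(2-5) by (simp add: a_minus_def a_ac minus_add)
  then show ?thesis using subgroup.m_closed[OF assms(1,6,7)] by simp
qed

end

text \<open>Two rows joined by restriction along \<open>f\<close>: exactness is assumed for the row
  over \<open>R\<close> only. The row over \<open>S\<close> is merely compatible with it, and its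
  exactness is what gets compared with the natural morphism.\<close>

locale base_change_presentation = base_change_map R S f M N \<rho>
  for R :: "'r ring" and S :: "'s ring" and f :: "'r \<Rightarrow> 's"
    and M :: "('r, 'm) module" and N :: "('s, 'n) module" and \<rho> :: "'m \<Rightarrow> 'n" +
  fixes I :: "'i set" and J :: "'j set"
    and \<phi> :: "('i \<Rightarrow> 'r) \<Rightarrow> 'j \<Rightarrow> 'r" and \<psi> :: "('j \<Rightarrow> 'r) \<Rightarrow> 'm"
    and \<phi>' :: "('i \<Rightarrow> 's) \<Rightarrow> 'j \<Rightarrow> 's" and \<psi>' :: "('j \<Rightarrow> 's) \<Rightarrow> 'n"
  assumes \<phi>: "\<phi> \<in> module_hom R (free_module R I) (free_module R J)"
    and \<psi>: "\<psi> \<in> module_hom R (free_module R J) M"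
    and \<phi>': "\<phi>' \<in> module_hom S (free_module S I) (free_module S J)"
    and \<psi>': "\<psi>' \<in> module_hom S (free_module S J) N"
    and comm_\<phi>: "h \<in> carrier (free_module R I) \<Longrightarrow> \<phi>' (map_vec f I h) = map_vec f J (\<phi> h)"
    and comm_\<psi>: "k \<in> carrier (free_module R J) \<Longrightarrow> \<psi>' (map_vec f J k) = \<rho> (\<psi> k)"
    and exact: "\<phi> ` carrier (free_module R I) = {k \<in> carrier (free_module R J). \<psi> k = \<zero>\<^bsub>M\<^esub>}"
    and surj: "\<psi> ` carrier (free_module R J) = carrier M"
begin

abbreviation "RI \<equiv> free_module R I"
abbreviation "RJ \<equiv> free_module R J"
abbreviation "SI \<equiv> free_module S I"
abbreviation "SJ \<equiv> free_module S J"
abbreviation "res \<equiv> map_vec f J"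

sublocale RI: Module.module R RI by (rule free_module_is_module[OF M.R.cring_axioms])
sublocale RJ: Module.module R RJ by (rule free_module_is_module[OF M.R.cring_axioms])
sublocale SI: Module.module S SI by (rule free_module_is_module[OF N.R.cring_axioms])
sublocale SJ: Module.module S SJ by (rule free_module_is_module[OF N.R.cring_axioms])

text \<open>Unfolded into coordinatewise functions, the operations would no longer match the module
  laws used below.\<close>

lemmas [simp del] = free_module_ops

lemmas res = map_vec_semilinear[OF M.R.cring_axioms N.R.cring_axioms ring_hom, of J]
lemmas res_unit_vec = map_vec_unit_vec[OF M.R.cring_axioms N.R.cring_axioms ring_hom]
lemmas unit_vec_RJ [simp] = unit_vec_closed[OF M.R.cring_axioms, of J]
lemmas unit_vec_RI [simp] = unit_vec_closed[OF M.R.cring_axioms, of I]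
lemmas unit_vec_SJ [simp] = unit_vec_closed[OF N.R.cring_axioms, of J]
lemmas unit_vec_SI [simp] = unit_vec_closed[OF N.R.cring_axioms, of I]
lemmas res_zero = semilinear_zero[OF RJ.abelian_group_axioms SJ.abelian_group_axioms res]
lemmas \<psi>_zero = semilinear_zero[OF RJ.abelian_group_axioms M.abelian_group_axioms
    \<psi>[unfolded module_hom_eq_semilinear]]
lemmas \<phi>'_zero = semilinear_zero[OF SI.abelian_group_axioms SJ.abelian_group_axioms
    \<phi>'[unfolded module_hom_eq_semilinear]]
lemmas \<psi>'_zero = semilinear_zero[OF SJ.abelian_group_axioms N.abelian_group_axioms
    \<psi>'[unfolded module_hom_eq_semilinear]]
lemmas SJ_induct = free_module_induct[OF N.R.cring_axioms, of _ J, consumes 1, case_names zero single add]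
lemmas SI_induct = free_module_induct[OF N.R.cring_axioms, of _ I, consumes 1, case_names zero single add]
lemmas RJ_induct = free_module_induct[OF M.R.cring_axioms, of _ J, consumes 1, case_names zero single add]

text \<open>A representative of the image of \<open>h\<close> under \<open>S\<^sup>J = R\<^sup>J \<otimes> S \<rightarrow> M \<otimes> S\<close>.\<close>

definition rep :: "('j \<Rightarrow> 's) \<Rightarrow> ('m \<times> 's) \<Rightarrow>\<^sub>0 int" where
  "rep h = (\<Sum>j\<in>{j \<in> J. h j \<noteq> \<zero>\<^bsub>S\<^esub>}. frag_of (\<psi> (unit_vec R J j), h j))"

lemma H_trans: "\<lbrakk>u - v \<in> H; v - w \<in> H\<rbrakk> \<Longrightarrow> u - w \<in> H"
  using H_closed(3)[of "u - v" "v - w"] by simp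

lemma H_sym: "u - v \<in> H \<Longrightarrow> v - u \<in> H"
  using H_closed(4)[of "u - v"] by simp

lemma H_add: "\<lbrakk>u - v \<in> H; u' - v' \<in> H\<rbrakk> \<Longrightarrow> (u + u') - (v + v') \<in> H"
  using H_closed(3)[of "u - v" "u' - v'"] by (simp add: algebra_simps)

lemma H_diff: "\<lbrakk>u - v \<in> H; u' - v' \<in> H\<rbrakk> \<Longrightarrow> (u - u') - (v - v') \<in> H"
  using H_closed(5)[of "u - v" "u' - v'"] by (simp add: algebra_simps)

lemma SJ_closed: "\<lbrakk>h \<in> carrier SJ; j \<in> J\<rbrakk> \<Longrightarrow> h j \<in> carrier S"
  by (auto simp: carrier_free_module)

lemma \<psi>_unit_vec [simp]: "\<psi> (unit_vec R J j) \<in> carrier M"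
  using module_homD(1)[OF \<psi>] by simp

lemma rep_keys: "h \<in> carrier SJ \<Longrightarrow> Poly_Mapping.keys (rep h) \<subseteq> carrier M \<times> carrier S"
proof -
  assume h: "h \<in> carrier SJ"
  have "rep h \<in> carrier F"
    unfolding rep_def by (rule sum_closed_free_Abelian_group) (use h SJ_closed in auto)
  then show ?thesis by simp
qed

lemma rep_zero: "rep \<zero>\<^bsub>SJ\<^esub> = 0"
  by (simp add: rep_def free_module_ops)

text \<open>Since the support of \<open>h\<close> varies with \<open>h\<close>, sums must be brought
  to a common index set. The extra terms are generators with second entry zero, and these lie in
  \<open>H\<close>.\<close>

lemma rep_cong:
  assumes "finite A" "{j \<in> J. h j \<noteq> \<zero>\<^bsub>S\<^esub>} \<subseteq> A" "A \<subseteq> J"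
  shows "(\<Sum>j\<in>A. frag_of (\<psi> (unit_vec R J j), h j)) - rep h \<in> H"
proof -
  have "(\<Sum>j\<in>A. frag_of (\<psi> (unit_vec R J j), h j)) - rep h =
      (\<Sum>j\<in>A - {j \<in> J. h j \<noteq> \<zero>\<^bsub>S\<^esub>}. frag_of (\<psi> (unit_vec R J j), h j))"
    unfolding rep_def by (rule sum_diff[OF assms(1,2), symmetric])
  also have "\<dots> \<in> H"
    by (rule H_sum) (use assms(3) tensor_zero_right in auto)
  finally show ?thesis .
qed

lemma rep_add:
  assumes h: "h \<in> carrier SJ" and k: "k \<in> carrier SJ"
  shows "rep (h \<oplus>\<^bsub>SJ\<^esub> k) - (rep h + rep k) \<in> H"
proof -
  define A where "A = {j \<in> J. h j \<noteq> \<zero>\<^bsub>S\<^esub>} \<union> {j \<in> J. k j \<noteq> \<zero>\<^bsub>S\<^esub>}"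
  define e where "e h = (\<Sum>j\<in>A. frag_of (\<psi> (unit_vec R J j), h j))" for h :: "'j \<Rightarrow> 's"
  have A: "finite A" "A \<subseteq> J" using h k by (auto simp: A_def carrier_free_module)
  have c: "e h - rep h \<in> H" "e k - rep k \<in> H" "e (h \<oplus>\<^bsub>SJ\<^esub> k) - rep (h \<oplus>\<^bsub>SJ\<^esub> k) \<in> H"
    unfolding e_def by (rule rep_cong[OF A(1) _ A(2)]; auto simp: A_def free_module_ops)+
  have "e (h \<oplus>\<^bsub>SJ\<^esub> k) - (e h + e k) = (\<Sum>j\<in>A. frag_of (\<psi> (unit_vec R J j), h j \<oplus>\<^bsub>S\<^esub> k j)
      - frag_of (\<psi> (unit_vec R J j), h j) - frag_of (\<psi> (unit_vec R J j), k j))"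
    using A(2) by (auto simp: e_def free_module_ops sum_subtractf sum.distrib[symmetric] diff_diff_eq
        intro!: sum.cong)
  also have "\<dots> \<in> H"
    by (rule H_sum) (use A(2) h k SJ_closed tensor_add_right in auto)
  finally show ?thesis
    using H_add[OF c(1,2)] H_sym[OF c(3)] H_trans by blast
qed

lemma rep_minus:
  assumes h: "h \<in> carrier SJ" and k: "k \<in> carrier SJ"
  shows "(rep h - rep k) - rep (h \<ominus>\<^bsub>SJ\<^esub> k) \<in> H"
proof -
  \<comment> \<open>Additivity applied to the difference plus \<open>k\<close> avoids a separate
    treatment of negatives.\<close>
  have "(h \<ominus>\<^bsub>SJ\<^esub> k) \<oplus>\<^bsub>SJ\<^esub> k = h" using h k by (simp add: a_minus_def SJ.a_assoc SJ.l_neg)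
  then have "rep h - (rep (h \<ominus>\<^bsub>SJ\<^esub> k) + rep k) \<in> H"
    using rep_add[of "h \<ominus>\<^bsub>SJ\<^esub> k" k] h k by simp
  then show ?thesis by (simp add: algebra_simps)
qed

lemma rep_single:
  assumes b: "b \<in> carrier S" and j: "j \<in> J"
  shows "rep (b \<odot>\<^bsub>SJ\<^esub> unit_vec S J j) - frag_of (\<psi> (unit_vec R J j), b) \<in> H"
proof -
  have *: "(b \<odot>\<^bsub>SJ\<^esub> unit_vec S J j) i = (if i = j then b else \<zero>\<^bsub>S\<^esub>)" if "i \<in> J" for i
    using b j that by (simp add: free_module_ops unit_vec_def)
  then have "{i \<in> J. (b \<odot>\<^bsub>SJ\<^esub> unit_vec S J j) i \<noteq> \<zero>\<^bsub>S\<^esub>} \<subseteq> {j}" by (auto split: if_splits)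
  from rep_cong[OF _ this] have "frag_of (\<psi> (unit_vec R J j), b) - rep (b \<odot>\<^bsub>SJ\<^esub> unit_vec S J j) \<in> H"
    using *[OF j] j by simp
  then show ?thesis by (rule H_sym)
qed

text \<open>In the identification of the free module over \<open>S\<close> with a base change,
  \<open>k\<close> tensored with \<open>b\<close> is \<open>b\<close> times \<open>res k\<close>.
  For a multiple of a unit vector the scalar \<open>a\<close> crosses the tensor sign as
  \<open>f a\<close>; the rest is additivity.\<close>

lemma rep_restrict:
  assumes k: "k \<in> carrier RJ" and b: "b \<in> carrier S"
  shows "rep (b \<odot>\<^bsub>SJ\<^esub> res k) - frag_of (\<psi> k, b) \<in> H"
  using k
proof (induction rule: RJ_induct)
  case zero
  show ?case using b H_closed(4)[OF tensor_zero_left[OF b]] by (simp add: res_zero rep_zero \<psi>_zero)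
next
  case (single a j)
  have "b \<odot>\<^bsub>SJ\<^esub> res (a \<odot>\<^bsub>RJ\<^esub> unit_vec R J j) = (f a \<otimes>\<^bsub>S\<^esub> b) \<odot>\<^bsub>SJ\<^esub> unit_vec S J j"
    using semilinearD(3)[OF res single(1), of "unit_vec R J j"] single b
    by (simp add: res_unit_vec SJ.smult_assoc1 N.R.m_comm)
  moreover have "\<psi> (a \<odot>\<^bsub>RJ\<^esub> unit_vec R J j) = a \<odot>\<^bsub>M\<^esub> \<psi> (unit_vec R J j)"
    using module_homD(3)[OF \<psi>] single by simp
  ultimately show ?case
    using H_trans[OF rep_single[of "f a \<otimes>\<^bsub>S\<^esub> b" j] H_sym[OF tensor_smult[of a "\<psi> (unit_vec R J j)" b]]]
      single b by simp
next
  case (add k k')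
  have cl: "res k \<in> carrier SJ" "res k' \<in> carrier SJ" using semilinearD(1)[OF res] add.hyps by auto
  have "rep (b \<odot>\<^bsub>SJ\<^esub> res (k \<oplus>\<^bsub>RJ\<^esub> k')) - (rep (b \<odot>\<^bsub>SJ\<^esub> res k) + rep (b \<odot>\<^bsub>SJ\<^esub> res k')) \<in> H"
    using rep_add[of "b \<odot>\<^bsub>SJ\<^esub> res k" "b \<odot>\<^bsub>SJ\<^esub> res k'"] cl b semilinearD(2)[OF res] add.hyps
    by (simp add: SJ.smult_r_distr)
  moreover have "frag_of (\<psi> (k \<oplus>\<^bsub>RJ\<^esub> k'), b) - (frag_of (\<psi> k, b) + frag_of (\<psi> k', b)) \<in> H"
    using tensor_add_left[of "\<psi> k" "\<psi> k'" b] module_homD(1,2)[OF \<psi>] add.hyps b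
    by (simp add: diff_diff_eq)
  ultimately show ?case using H_add[OF add.IH] by (blast intro: H_trans H_sym)
qed

text \<open>Only generators matter. For \<open>(x, b)\<close>, surjectivity of \<open>\<psi>\<close>
  provides a preimage \<open>k\<close> of \<open>x\<close>, and \<open>b\<close> times
  \<open>res k\<close> is a suitable vector by \<open>rep_restrict\<close>.\<close>

lemma ex_rep:
  assumes "Poly_Mapping.keys u \<subseteq> carrier M \<times> carrier S"
  shows "\<exists>h\<in>carrier SJ. u - rep h \<in> H"
proof (rule free_Abelian_group_induct[OF assms], goal_cases)
  case 1
  have "0 - rep \<zero>\<^bsub>SJ\<^esub> \<in> H" unfolding rep_zero using H_closed(2) by simp
  then show ?case using SJ.zero_closed by blast
next
  case (2 u v)
  then obtain h k where hk: "h \<in> carrier SJ" "k \<in> carrier SJ" "u - rep h \<in> H" "v - rep k \<in> H"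
    by metis
  have "u - v - rep (h \<ominus>\<^bsub>SJ\<^esub> k) \<in> H"
    by (rule H_trans[OF H_diff[OF hk(3,4)] rep_minus[OF hk(1,2)]])
  then show ?case using SJ.minus_closed[OF hk(1,2)] by (rule bexI)
next
  case (3 z)
  obtain x b where z: "z = (x, b)" "x \<in> carrier M" "b \<in> carrier S" using 3 by (cases z) simp
  obtain k where k: "k \<in> carrier RJ" "\<psi> k = x" using z(2) unfolding surj[symmetric] by (elim imageE) simp
  have "b \<odot>\<^bsub>SJ\<^esub> res k \<in> carrier SJ" using semilinearD(1)[OF res k(1)] z(3) by simp
  moreover have "frag_of z - rep (b \<odot>\<^bsub>SJ\<^esub> res k) \<in> H"
    using H_sym[OF rep_restrict[OF k(1) z(3)]] unfolding k(2) z(1) .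
  ultimately show ?case by blast
qed

lemma L_cong:
  assumes "u - v \<in> H" "Poly_Mapping.keys v \<subseteq> carrier M \<times> carrier S"
  shows "L u = L v"
  using L_simps(2)[OF H_closed(1)[OF assms(1)] assms(2)] L_relations[OF assms(1)] L_simps(1)[OF assms(2)]
  by simp

text \<open>Both sides are additive, and on multiples of unit vectors they agree by
  \<open>comm_\<psi>\<close>. This exhibits \<open>\<psi>'\<close> as the map to the tensor product
  followed by the natural morphism.\<close>

lemma L_rep: "h \<in> carrier SJ \<Longrightarrow> L (rep h) = \<psi>' h"
proof (induction rule: SJ_induct)
  case zero
  show ?case using L_relations[OF H_closed(2)] by (simp add: rep_zero \<psi>'_zero)
next
  case (single b j)
  have "L (rep (b \<odot>\<^bsub>SJ\<^esub> unit_vec S J j)) = b \<odot>\<^bsub>N\<^esub> \<rho> (\<psi> (unit_vec R J j))"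
    using L_cong[OF rep_single[OF single]] single by simp
  also have "\<dots> = b \<odot>\<^bsub>N\<^esub> \<psi>' (unit_vec S J j)"
    using comm_\<psi>[of "unit_vec R J j"] single by (simp add: res_unit_vec)
  also have "\<dots> = \<psi>' (b \<odot>\<^bsub>SJ\<^esub> unit_vec S J j)"
    using module_homD(3)[OF \<psi>'] single by simp
  finally show ?case .
next
  case (add h k)
  have "Poly_Mapping.keys (rep h + rep k) \<subseteq> carrier M \<times> carrier S"
    using keys_add[of "rep h" "rep k"] rep_keys add.hyps by blast
  then have "L (rep (h \<oplus>\<^bsub>SJ\<^esub> k)) = L (rep h) \<oplus>\<^bsub>N\<^esub> L (rep k)"
    using L_cong[OF rep_add[OF add.hyps]] L_simps(2) rep_keys add.hyps by simp
  then show ?case using add module_homD(2)[OF \<psi>'] by simp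
qed

text \<open>A unit vector goes under \<open>\<phi>'\<close> to the restriction of a relation over
  \<open>R\<close>, which \<open>\<psi>\<close> sends to zero. By \<open>rep_restrict\<close> its
  multiple by \<open>b\<close> is represented by the tensor of zero with \<open>b\<close>.\<close>

lemma rep_image: "h \<in> carrier SI \<Longrightarrow> rep (\<phi>' h) \<in> H"
proof (induction rule: SI_induct)
  case zero
  show ?case using H_closed(2) by (simp add: \<phi>'_zero rep_zero)
next
  case (single b i)
  have \<phi>i: "\<phi> (unit_vec R I i) \<in> carrier RJ" "\<psi> (\<phi> (unit_vec R I i)) = \<zero>\<^bsub>M\<^esub>"
    using imageI[OF unit_vec_RI, of \<phi> i] unfolding exact by simp_all
  have "\<phi>' (b \<odot>\<^bsub>SI\<^esub> unit_vec S I i) = b \<odot>\<^bsub>SJ\<^esub> res (\<phi> (unit_vec R I i))"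
    using module_homD(3)[OF \<phi>'] single comm_\<phi>[of "unit_vec R I i"] by (simp add: res_unit_vec)
  then show ?case
    using H_closed(3)[OF rep_restrict[OF \<phi>i(1) single(1)] tensor_zero_left[OF single(1)]] \<phi>i(2) by simp
next
  case (add h k)
  have cl: "\<phi>' h \<in> carrier SJ" "\<phi>' k \<in> carrier SJ" using module_homD(1)[OF \<phi>'] add.hyps by auto
  then show ?case
    using H_closed(3)[OF rep_add[OF cl] H_closed(3)[OF add.IH]] module_homD(2)[OF \<phi>'] add.hyps by simp
qed

abbreviation "B \<equiv> \<phi>' ` carrier SI"

lemma subgroup_B: "subgroup B (add_monoid SJ)"
  using group_hom.img_is_subgroup[OF semilinear_add_hom[OF SI.abelian_group_axioms SJ.abelian_group_axioms
    \<phi>'[unfolded module_hom_eq_semilinear]]] by simp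

text \<open>Exactness over \<open>R\<close> writes \<open>k\<close> as a value of
  \<open>\<phi>\<close>, and the square \<open>comm_\<phi>\<close> moves it into the image of
  \<open>\<phi>'\<close>. This is what makes the inverse map independent of the chosen
  preimages.\<close>

lemma smult_res_kernel:
  assumes "k \<in> carrier RJ" "\<psi> k = \<zero>\<^bsub>M\<^esub>" "b \<in> carrier S"
  shows "b \<odot>\<^bsub>SJ\<^esub> res k \<in> B"
proof -
  obtain h where h: "h \<in> carrier RI" "k = \<phi> h"
    using assms(1,2) exact by (metis (mono_tags, lifting) imageE mem_Collect_eq)
  define h' where "h' = map_vec f I h"
  have h': "h' \<in> carrier SI"
    using semilinearD(1)[OF map_vec_semilinear[OF M.R.cring_axioms N.R.cring_axioms ring_hom] h(1)]
    by (simp add: h'_def)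
  have "b \<odot>\<^bsub>SJ\<^esub> res k = \<phi>' (b \<odot>\<^bsub>SI\<^esub> h')"
    using module_homD(3)[OF \<phi>' assms(3) h'] comm_\<phi>[OF h(1)] h(2) by (simp add: h'_def)
  then show ?thesis using h' assms(3) by simp
qed

text \<open>The inverse of \<open>S\<^sup>J / im \<phi>' \<rightarrow> M \<otimes> S\<close> sends \<open>x \<otimes> b\<close> to \<open>b k\<close> for any preimage \<open>k\<close> of \<open>x\<close>
  under \<open>\<psi>\<close>; it is used here before passing to the quotients.\<close>

lemma rep_in_H_imp_image:
  assumes h: "h \<in> carrier SJ" "rep h \<in> H"
  shows "h \<in> B"
proof -
  have "\<forall>x\<in>carrier M. \<exists>k. k \<in> carrier RJ \<and> \<psi> k = x"
    unfolding surj[symmetric] by blast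
  \<comment> \<open>\<open>l\<close> is an arbitrary section of \<open>\<psi>\<close>, in general
    neither additive nor linear; \<open>ker\<close> bounds the resulting error by
    \<open>B\<close>.\<close>
  from bchoice[OF this] obtain l where l: "\<forall>x\<in>carrier M. l x \<in> carrier RJ \<and> \<psi> (l x) = x" ..
  define \<Lambda> where "\<Lambda> = free_lift SJ (\<lambda>(x, b). b \<odot>\<^bsub>SJ\<^esub> res (l x))"
  have cl [simp]: "l x \<in> carrier RJ" "\<psi> (l x) = x" "res (l x) \<in> carrier SJ" if "x \<in> carrier M" for x
    using bspec[OF l that] semilinearD(1)[OF res, of "l x"] by auto
  have ker: "b \<odot>\<^bsub>SJ\<^esub> res k \<ominus>\<^bsub>SJ\<^esub> b \<odot>\<^bsub>SJ\<^esub> res k' \<in> B"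
    if "k \<in> carrier RJ" "k' \<in> carrier RJ" "\<psi> k = \<psi> k'" "b \<in> carrier S" for k k' b
  proof -
    have "\<psi> (k \<ominus>\<^bsub>RJ\<^esub> k') = \<zero>\<^bsub>M\<^esub>"
      using semilinear_minus[OF RJ.abelian_group_axioms M.abelian_group_axioms
        \<psi>[unfolded module_hom_eq_semilinear] that(1,2)] that(3) module_homD(1)[OF \<psi> that(2)]
      by (simp add: a_minus_def M.r_neg)
    moreover have "b \<odot>\<^bsub>SJ\<^esub> res (k \<ominus>\<^bsub>RJ\<^esub> k') = b \<odot>\<^bsub>SJ\<^esub> res k \<ominus>\<^bsub>SJ\<^esub> b \<odot>\<^bsub>SJ\<^esub> res k'"
      using semilinear_minus[OF RJ.abelian_group_axioms SJ.abelian_group_axioms res that(1,2)] that(4)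
        semilinearD(1)[OF res that(1)] semilinearD(1)[OF res that(2)]
      by (simp add: a_minus_def SJ.smult_r_distr SJ.smult_r_minus)
    ultimately show ?thesis
      using smult_res_kernel[of "k \<ominus>\<^bsub>RJ\<^esub> k'" b] that by simp
  qed
  have self_minus: "x \<ominus>\<^bsub>SJ\<^esub> x = \<zero>\<^bsub>SJ\<^esub>" if "x \<in> carrier SJ" for x
    using that by (simp add: a_minus_def SJ.r_neg)
  have minus_minus: "x \<ominus>\<^bsub>SJ\<^esub> y \<ominus>\<^bsub>SJ\<^esub> z = x \<ominus>\<^bsub>SJ\<^esub> (y \<oplus>\<^bsub>SJ\<^esub> z)"
    if "x \<in> carrier SJ" "y \<in> carrier SJ" "z \<in> carrier SJ" for x y z
    using that by (simp add: a_minus_def SJ.minus_add SJ.a_assoc)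
  interpret \<Lambda>: group_hom F "add_monoid SJ" \<Lambda>
    unfolding \<Lambda>_def
    by (intro group_hom.intro group_hom_axioms.intro free_lift_hom)
      (auto simp: SJ.a_group SJ.abelian_group_axioms)
  have \<Lambda>_of: "\<Lambda> (frag_of (x, b)) = b \<odot>\<^bsub>SJ\<^esub> res (l x)" if "x \<in> carrier M" "b \<in> carrier S" for x b
    using free_lift_of[OF SJ.abelian_group_axioms, of "\<lambda>(x, b). b \<odot>\<^bsub>SJ\<^esub> res (l x)" "(x, b)"] that
    by (simp add: \<Lambda>_def)
  have zero_B: "\<zero>\<^bsub>SJ\<^esub> \<in> B" using subgroup.one_closed[OF subgroup_B] by simp
  \<comment> \<open>For each relation involving \<open>l\<close>, the two candidate preimages have
    the same image under \<open>\<psi>\<close>, so \<open>ker\<close> applies. Additivity in the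
    scalar holds exactly.\<close>
  have \<Lambda>_H: "\<Lambda> u \<in> B" if u: "u \<in> H" for u
    unfolding \<Lambda>_def
  proof (rule free_lift_tensor_relations[OF module_M module_T SJ.abelian_group_axioms subgroup_B _ _ _ _ u],
      unfold T_simps)
    show "b \<odot>\<^bsub>SJ\<^esub> res (l x) \<in> carrier SJ" if "x \<in> carrier M" "b \<in> carrier S" for x b
      using that by simp
    show "b \<odot>\<^bsub>SJ\<^esub> res (l (x \<oplus>\<^bsub>M\<^esub> x')) \<ominus>\<^bsub>SJ\<^esub> b \<odot>\<^bsub>SJ\<^esub> res (l x) \<ominus>\<^bsub>SJ\<^esub> b \<odot>\<^bsub>SJ\<^esub> res (l x') \<in> B"
      if "x \<in> carrier M" "x' \<in> carrier M" "b \<in> carrier S" for x x' b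
      using ker[of "l (x \<oplus>\<^bsub>M\<^esub> x')" "l x \<oplus>\<^bsub>RJ\<^esub> l x'" b] that module_homD(2)[OF \<psi>, of "l x" "l x'"]
        semilinearD(2)[OF res, of "l x" "l x'"]
      by (simp add: SJ.smult_r_distr minus_minus)
    show "(b \<oplus>\<^bsub>S\<^esub> b') \<odot>\<^bsub>SJ\<^esub> res (l x) \<ominus>\<^bsub>SJ\<^esub> b \<odot>\<^bsub>SJ\<^esub> res (l x) \<ominus>\<^bsub>SJ\<^esub> b' \<odot>\<^bsub>SJ\<^esub> res (l x) \<in> B"
      if "x \<in> carrier M" "b \<in> carrier S" "b' \<in> carrier S" for x b b'
      using that zero_B by (simp add: SJ.smult_l_distr minus_minus self_minus)
    show "b \<odot>\<^bsub>SJ\<^esub> res (l (a \<odot>\<^bsub>M\<^esub> x)) \<ominus>\<^bsub>SJ\<^esub> (f a \<otimes>\<^bsub>S\<^esub> b) \<odot>\<^bsub>SJ\<^esub> res (l x) \<in> B"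
      if "a \<in> carrier R" "x \<in> carrier M" "b \<in> carrier S" for a x b
      using ker[of "l (a \<odot>\<^bsub>M\<^esub> x)" "a \<odot>\<^bsub>RJ\<^esub> l x" b] that module_homD(3)[OF \<psi>, of a "l x"]
        semilinearD(3)[OF res, of a "l x"]
      by (simp add: SJ.smult_assoc1[symmetric] N.R.m_comm)
  qed
  have \<Lambda>_cong: "\<Lambda> u \<ominus>\<^bsub>SJ\<^esub> \<Lambda> v \<in> B"
    if "u - v \<in> H" "Poly_Mapping.keys u \<subseteq> carrier M \<times> carrier S"
      "Poly_Mapping.keys v \<subseteq> carrier M \<times> carrier S" for u v
    using \<Lambda>_H[OF that(1)] \<Lambda>.hom_mult[of u "- v"] \<Lambda>.hom_inv[of v] that by (simp add: a_minus_def a_inv_def)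
  have \<Lambda>_closed: "\<Lambda> u \<in> carrier SJ" if "Poly_Mapping.keys u \<subseteq> carrier M \<times> carrier S" for u
    using \<Lambda>.hom_closed[of u] that by simp
  \<comment> \<open>Here \<open>\<Lambda>\<close> is shown to be a left inverse of
    \<open>rep\<close> modulo \<open>B\<close>. On a unit vector the chosen preimage of its image
    under \<open>\<psi>\<close> may differ from it, but only by a relation.\<close>
  have "\<Lambda> (rep h) \<ominus>\<^bsub>SJ\<^esub> h \<in> B" if "h \<in> carrier SJ" for h
    using that
  proof (induction rule: SJ_induct)
    case zero
    have "\<Lambda> (rep \<zero>\<^bsub>SJ\<^esub>) = \<zero>\<^bsub>SJ\<^esub>" unfolding rep_zero using \<Lambda>.hom_one by simp
    then show ?case by (simp only: self_minus[OF SJ.zero_closed] zero_B)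
  next
    case (single b j)
    have "\<Lambda> (frag_of (\<psi> (unit_vec R J j), b)) \<ominus>\<^bsub>SJ\<^esub> b \<odot>\<^bsub>SJ\<^esub> unit_vec S J j \<in> B"
      using ker[of "l (\<psi> (unit_vec R J j))" "unit_vec R J j" b] single by (simp add: \<Lambda>_of res_unit_vec)
    then show ?case
      using SJ.subgroup_cong_trans[OF subgroup_B _ _ _ \<Lambda>_cong[OF rep_single[OF single]]] single
      by (simp add: \<Lambda>_closed rep_keys)
  next
    case (add h k)
    have "Poly_Mapping.keys (rep h + rep k) \<subseteq> carrier M \<times> carrier S"
      using keys_add[of "rep h" "rep k"] rep_keys add.hyps by blast
    then have "\<Lambda> (rep (h \<oplus>\<^bsub>SJ\<^esub> k)) \<ominus>\<^bsub>SJ\<^esub> (\<Lambda> (rep h) \<oplus>\<^bsub>SJ\<^esub> \<Lambda> (rep k)) \<in> B"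
      using \<Lambda>_cong[OF rep_add[OF add.hyps]] \<Lambda>.hom_mult[of "rep h" "rep k"] rep_keys add.hyps by simp
    then show ?case
      using SJ.subgroup_cong_trans[OF subgroup_B _ _ _ _ SJ.subgroup_cong_add[OF subgroup_B _ _ _ _ add.IH]]
        add.hyps by (simp add: \<Lambda>_closed rep_keys)
  qed
  from this[OF h(1)] have d: "\<Lambda> (rep h) \<ominus>\<^bsub>SJ\<^esub> h \<in> B" .
  have \<Lambda>h: "\<Lambda> (rep h) \<in> carrier SJ" by (rule \<Lambda>_closed[OF rep_keys[OF h(1)]])
  \<comment> \<open>\<open>h\<close> is \<open>\<Lambda> (rep h)\<close> minus the error just
    bounded; the first term lies in \<open>B\<close> because \<open>rep h\<close> is a
    relation.\<close>
  have "\<ominus>\<^bsub>SJ\<^esub> (\<Lambda> (rep h) \<ominus>\<^bsub>SJ\<^esub> h) \<in> B"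
    using subgroup.m_inv_closed[OF subgroup_B d] by (simp only: a_inv_def)
  from subgroup.m_closed[OF subgroup_B \<Lambda>_H[OF h(2)] this]
  have "\<Lambda> (rep h) \<oplus>\<^bsub>SJ\<^esub> \<ominus>\<^bsub>SJ\<^esub> (\<Lambda> (rep h) \<ominus>\<^bsub>SJ\<^esub> h) \<in> B" by (simp only: monoid.simps)
  moreover have "\<Lambda> (rep h) \<oplus>\<^bsub>SJ\<^esub> \<ominus>\<^bsub>SJ\<^esub> (\<Lambda> (rep h) \<ominus>\<^bsub>SJ\<^esub> h) = h"
    by (simp only: a_minus_def SJ.minus_add[OF \<Lambda>h SJ.a_inv_closed[OF h(1)]]
        SJ.minus_minus[OF h(1)] SJ.r_neg2[OF \<Lambda>h h(1)])
  ultimately show ?thesis by (simp only:)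
qed

text \<open>Modulo \<open>B\<close> and \<open>H\<close>, \<open>rep\<close> is a bijection that
  carries \<open>\<psi>'\<close> to \<open>L\<close>. Images and kernels therefore correspond, and
  the criterion \<open>tensor_lift_iso_iff\<close> translates into exactness of the row over
  \<open>S\<close>.\<close>

lemma iso_iff_exact:
  "tensor_lift N (\<lambda>x s. s \<odot>\<^bsub>N\<^esub> \<rho> x) \<in> module_iso S (base_change R S f M) N \<longleftrightarrow>
    \<phi>' ` carrier SI = {h \<in> carrier SJ. \<psi>' h = \<zero>\<^bsub>N\<^esub>} \<and> \<psi>' ` carrier SJ = carrier N"
proof -
  have L_image: "L ` carrier F = \<psi>' ` carrier SJ"
  proof (intro subset_antisym image_subsetI)
    fix u assume "u \<in> carrier F"
    then obtain h where h: "h \<in> carrier SJ" "u - rep h \<in> H" using ex_rep[of u] by auto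
    then have "L u = \<psi>' h" using L_cong[OF h(2) rep_keys[OF h(1)]] L_rep[OF h(1)] by simp
    then show "L u \<in> \<psi>' ` carrier SJ" using h(1) by (rule image_eqI)
  next
    fix h assume h: "h \<in> carrier SJ"
    have "rep h \<in> carrier F" using rep_keys[OF h] by simp
    with L_rep[OF h, symmetric] show "\<psi>' h \<in> L ` carrier F" by (rule image_eqI)
  qed
  \<comment> \<open>The row over \<open>S\<close> is always a complex, so only the opposite
    inclusion is at stake.\<close>
  have B_subset: "B \<subseteq> {h \<in> carrier SJ. \<psi>' h = \<zero>\<^bsub>N\<^esub>}"
  proof (intro image_subsetI CollectI conjI)
    fix h assume h: "h \<in> carrier SI"
    show *: "\<phi>' h \<in> carrier SJ" by (rule module_homD(1)[OF \<phi>' h])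
    show "\<psi>' (\<phi>' h) = \<zero>\<^bsub>N\<^esub>" using L_rep[OF *] L_relations[OF rep_image[OF h]] by simp
  qed
  have "(\<forall>u\<in>carrier F. L u = \<zero>\<^bsub>N\<^esub> \<longrightarrow> u \<in> H) \<longleftrightarrow> (\<forall>h\<in>carrier SJ. \<psi>' h = \<zero>\<^bsub>N\<^esub> \<longrightarrow> h \<in> B)"
  proof (intro iffI ballI impI)
    fix h assume *: "\<forall>u\<in>carrier F. L u = \<zero>\<^bsub>N\<^esub> \<longrightarrow> u \<in> H" and h: "h \<in> carrier SJ" "\<psi>' h = \<zero>\<^bsub>N\<^esub>"
    then have "rep h \<in> H" using L_rep[OF h(1)] rep_keys[OF h(1)] by simp
    then show "h \<in> B" by (rule rep_in_H_imp_image[OF h(1)])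
  next
    fix u assume *: "\<forall>h\<in>carrier SJ. \<psi>' h = \<zero>\<^bsub>N\<^esub> \<longrightarrow> h \<in> B" and u: "u \<in> carrier F" "L u = \<zero>\<^bsub>N\<^esub>"
    obtain h where h: "h \<in> carrier SJ" "u - rep h \<in> H" using ex_rep[of u] u(1) by auto
    have "\<psi>' h = \<zero>\<^bsub>N\<^esub>" using L_cong[OF h(2) rep_keys[OF h(1)]] L_rep[OF h(1)] u(2) by simp
    with * h(1) have "h \<in> B" by simp
    then have "rep h \<in> H" using rep_image by (elim imageE) simp
    from H_closed(3)[OF h(2) this] show "u \<in> H" by simp
  qed
  also have "\<dots> \<longleftrightarrow> {h \<in> carrier SJ. \<psi>' h = \<zero>\<^bsub>N\<^esub>} \<subseteq> B" by (simp only: subset_iff mem_Collect_eq Ball_def imp_conjL)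
  finally show ?thesis
    unfolding tensor_lift_iso_iff L_image set_eq_subset[of B] using B_subset by (simp only: simp_thms conj_commute)
qed

end

section \<open>Exactness on stalks\<close>

lemma sheaf_of_sets_subtopology:
  assumes "sheaf_of_sets X F \<rho>" "openin X U"
  shows "sheaf_of_sets (subtopology X U) F \<rho>"
proof -
  interpret sheaf_of_sets X F \<rho> by fact
  note op = openin_open_subtopology[OF assms(2)]
  show ?thesis
  proof (unfold_locales, goal_cases)
    case (4 \<V> s t)
    show ?case by (rule locality[OF _ 4(2,3,4)]) (use 4(1) op in simp)
  next
    case (5 \<V> \<sigma>)
    show ?case by (rule gluing[OF _ 5(2,3)]) (use 5(1) op in simp)
  qed (simp_all add: op restr_closed restr_id restr_comp)
qed

lemma ringed_space_subtopology:
  assumes "ringed_space X \<O>" "openin X U"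
  shows "ringed_space (subtopology X U) \<O>"
proof -
  interpret ringed_space X \<O> by fact
  show ?thesis
    by (intro ringed_space.intro ringed_space_axioms.intro
        sheaf_of_sets_subtopology[OF sheaf_of_sets_axioms assms(2)])
      (simp_all add: openin_open_subtopology[OF assms(2)] sections_cring restr_ring_hom)
qed

lemma ringed_finite_space_subtopology:
  assumes "ringed_finite_space X \<O>" "openin X U"
  shows "ringed_finite_space (subtopology X U) \<O>"
  using assms by (simp add: ringed_finite_space_def ringed_finite_space_axioms_def ringed_space_subtopology)

lemma sheaf_of_modules_subtopology:
  assumes "sheaf_of_modules X \<O> \<M>" "openin X U"
  shows "sheaf_of_modules (subtopology X U) \<O> \<M>"
proof -
  interpret sheaf_of_modules X \<O> \<M> by fact
  show ?thesis
    by (intro sheaf_of_modules.intro sheaf_of_modules_axioms.intro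
        ringed_space_subtopology[OF ringed_space_axioms assms(2)]
        sheaf_of_sets_subtopology[OF M.sheaf_of_sets_axioms assms(2)])
      (simp_all add: openin_open_subtopology[OF assms(2)] sections_module restr_add restr_smult)
qed

lemma min_open_subtopology:
  assumes "openin X U" "p \<in> U"
  shows "min_open (subtopology X U) p = min_open X p"
proof
  show "min_open (subtopology X U) p \<subseteq> min_open X p"
  proof
    fix x assume x: "x \<in> min_open (subtopology X U) p"
    have "x \<in> V" if "openin X V" "p \<in> V" for V
    proof -
      have "openin (subtopology X U) (V \<inter> U)" using that assms by (simp add: openin_open_subtopology openin_Int)
      then show ?thesis using x that assms(2) by (auto simp: min_open_def)
    qed
    then show "x \<in> min_open X p" by (simp add: min_open_def)
  qed
  show "min_open X p \<subseteq> min_open (subtopology X U) p"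
    using assms by (auto simp: min_open_def openin_open_subtopology)
qed

lemma sheaf_homD:
  assumes "\<phi> \<in> sheaf_hom X \<O> \<F> \<G>"
  shows "openin X U \<Longrightarrow> \<phi> U \<in> module_hom (sections \<O> U) (sections \<F> U) (sections \<G> U)"
    and "\<lbrakk>openin X U; openin X V; V \<subseteq> U; s \<in> carrier (sections \<F> U)\<rbrakk>
      \<Longrightarrow> \<phi> V (restr \<F> U V s) = restr \<G> U V (\<phi> U s)"
  using assms by (auto simp: sheaf_hom_def)

lemma (in sheaf_of_modules) restr_semilinear:
  assumes "openin X U" "openin X V" "V \<subseteq> U"
  shows "restr \<M> U V \<in> semilinear (sections \<O> U) (restr \<O> U V) (sections \<M> U) (sections \<M> V)"
  using M.restr_closed[OF assms] restr_add[OF assms] restr_smult[OF assms]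
  by (auto simp: semilinear_def)

lemma (in sheaf_of_modules) restr_zero:
  assumes "openin X U" "openin X V" "V \<subseteq> U"
  shows "restr \<M> U V \<zero>\<^bsub>sections \<M> U\<^esub> = \<zero>\<^bsub>sections \<M> V\<^esub>"
  using semilinear_zero[OF _ _ restr_semilinear[OF assms]] sections_module[OF assms(1)]
    sections_module[OF assms(2)] by (simp add: Module.module_def)

text \<open>Every open neighbourhood of \<open>x\<close> contains the minimal one, and a local
  preimage can be restricted to it. The existential over neighbourhoods thus has a canonical
  witness.\<close>

lemma mem_sheaf_image_iff:
  assumes "finite (topspace X)" "sheaf_of_modules X \<O> \<F>" "sheaf_of_modules X \<O> \<G>"
    and \<phi>: "\<phi> \<in> sheaf_hom X \<O> \<F> \<G>" and U: "openin X U"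
  shows "s \<in> sheaf_image X \<F> \<G> \<phi> U \<longleftrightarrow> s \<in> carrier (sections \<G> U) \<and>
    (\<forall>x\<in>U. restr \<G> U (min_open X x) s \<in> \<phi> (min_open X x) ` carrier (sections \<F> (min_open X x)))"
proof -
  interpret F: sheaf_of_modules X \<O> \<F> by fact
  interpret G: sheaf_of_modules X \<O> \<G> by fact
  have mo: "openin X (min_open X x)" "x \<in> min_open X x" "min_open X x \<subseteq> V" if "openin X V" "x \<in> V" for x V
    using min_open_is_least[OF assms(1)] that openin_subset[OF that(1)] by blast+
  have "(\<exists>V. openin X V \<and> x \<in> V \<and> V \<subseteq> U \<and> restr \<G> U V s \<in> \<phi> V ` carrier (sections \<F> V)) \<longleftrightarrow>
      restr \<G> U (min_open X x) s \<in> \<phi> (min_open X x) ` carrier (sections \<F> (min_open X x))"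
    if s: "s \<in> carrier (sections \<G> U)" and x: "x \<in> U" for x
  proof
    assume "\<exists>V. openin X V \<and> x \<in> V \<and> V \<subseteq> U \<and> restr \<G> U V s \<in> \<phi> V ` carrier (sections \<F> V)"
    then obtain V t where V: "openin X V" "x \<in> V" "V \<subseteq> U"
      and t: "t \<in> carrier (sections \<F> V)" "restr \<G> U V s = \<phi> V t" by blast
    note m = mo[OF V(1,2)]
    have "restr \<G> U (min_open X x) s = restr \<G> V (min_open X x) (restr \<G> U V s)"
      using G.M.restr_comp[OF U V(1) m(1,3) V(3) s] by simp
    also have "\<dots> = \<phi> (min_open X x) (restr \<F> V (min_open X x) t)"
      using sheaf_homD(2)[OF \<phi> V(1) m(1,3) t(1)] t(2) by simp
    finally show "restr \<G> U (min_open X x) s \<in> \<phi> (min_open X x) ` carrier (sections \<F> (min_open X x))"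
      using F.M.restr_closed[OF V(1) m(1,3) t(1)] by (rule image_eqI)
  qed (use mo[OF U x] in blast)
  then show ?thesis by (auto simp: sheaf_image_def)
qed

definition exact_on :: "('x, 'r, 'l) module_presheaf \<Rightarrow> ('x, 'r, 'm) module_presheaf
      \<Rightarrow> ('x, 'r, 'n) module_presheaf \<Rightarrow> ('x set \<Rightarrow> 'l \<Rightarrow> 'm) \<Rightarrow> ('x set \<Rightarrow> 'm \<Rightarrow> 'n) \<Rightarrow> 'x set \<Rightarrow> bool" where
  "exact_on \<F> \<G> \<H> \<phi> \<psi> V \<longleftrightarrow>
     \<phi> V ` carrier (sections \<F> V) = {s \<in> carrier (sections \<G> V). \<psi> V s = \<zero>\<^bsub>sections \<H> V\<^esub>} \<and>
     \<psi> V ` carrier (sections \<G> V) = carrier (sections \<H> V)"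

text \<open>Belonging to the image sheaf or to the kernel can be tested on the minimal open sets of
  the points of \<open>U\<close>. Over a minimal open set the image sheaf has no sections beyond the
  actual image, so there both tests are plain module exactness.\<close>

lemma right_exact_sequence_iff_exact_on_stalks:
  assumes "ringed_finite_space X \<O>" "sheaf_of_modules X \<O> \<F>" "sheaf_of_modules X \<O> \<G>"
    "sheaf_of_modules X \<O> \<H>"
    and \<phi>: "\<phi> \<in> sheaf_hom X \<O> \<F> \<G>" and \<psi>: "\<psi> \<in> sheaf_hom X \<O> \<G> \<H>"
  shows "right_exact_sequence X \<O> \<F> \<G> \<H> \<phi> \<psi> \<longleftrightarrow>
    (\<forall>p\<in>topspace X. exact_on \<F> \<G> \<H> \<phi> \<psi> (min_open X p))"
proof -
  interpret X: ringed_finite_space X \<O> by fact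
  interpret F: sheaf_of_modules X \<O> \<F> by fact
  interpret G: sheaf_of_modules X \<O> \<G> by fact
  interpret H: sheaf_of_modules X \<O> \<H> by fact
  note mo = min_open_is_least[OF X.finite_topspace]
  note image_\<phi> = mem_sheaf_image_iff[OF X.finite_topspace assms(2,3) \<phi>]
  note image_\<psi> = mem_sheaf_image_iff[OF X.finite_topspace assms(3,4) \<psi>]
  \<comment> \<open>At the point \<open>p\<close> itself the minimal neighbourhood is the whole open
    set, so being locally in the image already means being in the image.\<close>
  have min_open_image: "sheaf_image X \<A> \<B> \<theta> (min_open X p) =
      \<theta> (min_open X p) ` carrier (sections \<A> (min_open X p))"
    if p: "p \<in> topspace X" and "sheaf_of_modules X \<O> \<A>" "sheaf_of_modules X \<O> \<B>"
      "\<theta> \<in> sheaf_hom X \<O> \<A> \<B>"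
    for p and \<A> :: "('a, 'b, 'k) module_presheaf" and \<B> :: "('a, 'b, 'l) module_presheaf" and \<theta>
  proof -
    interpret B: sheaf_of_modules X \<O> \<B> by fact
    note U = mo(1,2)[OF p]
    show ?thesis
    proof (intro subset_antisym subsetI)
      fix s assume s: "s \<in> sheaf_image X \<A> \<B> \<theta> (min_open X p)"
      then have "s \<in> carrier (sections \<B> (min_open X p))" by (simp add: sheaf_image_def)
      then show "s \<in> \<theta> (min_open X p) ` carrier (sections \<A> (min_open X p))"
        using s U B.M.restr_id[OF U(1), of s]
        unfolding mem_sheaf_image_iff[OF X.finite_topspace that(2-4) U(1)] by force
    next
      fix s assume s: "s \<in> \<theta> (min_open X p) ` carrier (sections \<A> (min_open X p))"
      have "s \<in> carrier (sections \<B> (min_open X p))"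
        using s module_homD(1)[OF sheaf_homD(1)[OF that(4) U(1)]] by blast
      then show "s \<in> sheaf_image X \<A> \<B> \<theta> (min_open X p)"
        using s U B.M.restr_id[OF U(1), of s] unfolding sheaf_image_def by auto
    qed
  qed
  show ?thesis
  proof
    assume "right_exact_sequence X \<O> \<F> \<G> \<H> \<phi> \<psi>"
    then show "\<forall>p\<in>topspace X. exact_on \<F> \<G> \<H> \<phi> \<psi> (min_open X p)"
      using mo(1) min_open_image[OF _ assms(2,3) \<phi>] min_open_image[OF _ assms(3,4) \<psi>]
      by (auto simp: right_exact_sequence_def exact_on_def sheaf_kernel_def)
  next
    assume *: "\<forall>p\<in>topspace X. exact_on \<F> \<G> \<H> \<phi> \<psi> (min_open X p)"
    have "sheaf_image X \<F> \<G> \<phi> U = sheaf_kernel \<G> \<H> \<psi> U \<and>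
        sheaf_image X \<G> \<H> \<psi> U = carrier (sections \<H> U)" if U: "openin X U" for U
    proof -
      have ex: "exact_on \<F> \<G> \<H> \<phi> \<psi> (min_open X x)" and m: "openin X (min_open X x)"
        "x \<in> min_open X x" "min_open X x \<subseteq> U" if "x \<in> U" for x
        using * mo openin_subset[OF U] U that by blast+
      \<comment> \<open>The minimal open sets of the points of \<open>U\<close> cover
        \<open>U\<close>, so vanishing of a section follows from vanishing on each of them by
        locality.\<close>
      have loc: "\<psi> U s = \<zero>\<^bsub>sections \<H> U\<^esub> \<longleftrightarrow>
          (\<forall>x\<in>U. \<psi> (min_open X x) (restr \<G> U (min_open X x) s) = \<zero>\<^bsub>sections \<H> (min_open X x)\<^esub>)"
        if s: "s \<in> carrier (sections \<G> U)" for s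
      proof -
        have eq: "\<psi> (min_open X x) (restr \<G> U (min_open X x) s) = restr \<H> U (min_open X x) (\<psi> U s)"
          "\<zero>\<^bsub>sections \<H> (min_open X x)\<^esub> = restr \<H> U (min_open X x) \<zero>\<^bsub>sections \<H> U\<^esub>" if "x \<in> U" for x
          using sheaf_homD(2)[OF \<psi> U m(1,3)[OF that] s] H.restr_zero[OF U m(1,3)[OF that]] by simp_all
        have cover: "\<Union> (min_open X ` U) = U" using m(2,3) by blast
        interpret HU: Module.module "sections \<O> U" "sections \<H> U" by (rule H.sections_module[OF U])
        have "\<psi> U s = \<zero>\<^bsub>sections \<H> U\<^esub>"
          if "\<And>x. x \<in> U \<Longrightarrow> restr \<H> U (min_open X x) (\<psi> U s) = restr \<H> U (min_open X x) \<zero>\<^bsub>sections \<H> U\<^esub>"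
          by (rule H.M.locality[of "min_open X ` U"])
            (use that m(1) module_homD(1)[OF sheaf_homD(1)[OF \<psi> U] s] in \<open>auto simp: cover\<close>)
        then show ?thesis by (auto simp: eq)
      qed
      have "s \<in> sheaf_image X \<F> \<G> \<phi> U \<longleftrightarrow> s \<in> sheaf_kernel \<G> \<H> \<psi> U" for s
        using ex G.M.restr_closed[OF U m(1,3)] loc
        by (auto simp: image_\<phi>[OF U] sheaf_kernel_def exact_on_def)
      moreover have "s \<in> sheaf_image X \<G> \<H> \<psi> U \<longleftrightarrow> s \<in> carrier (sections \<H> U)" for s
        using ex H.M.restr_closed[OF U m(1,3)] by (auto simp: image_\<psi>[OF U] exact_on_def)
      ultimately show ?thesis by blast
    qed
    then show "right_exact_sequence X \<O> \<F> \<G> \<H> \<phi> \<psi>" using \<phi> \<psi> by (simp add: right_exact_sequence_def)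
  qed
qed

section \<open>Quasi-coherence on finite spaces\<close>

lemma free_sheaf_simps:
  "sections (free_sheaf \<O> I) U = free_module (sections \<O> U) I"
  "restr (free_sheaf \<O> I) U V = map_vec (restr \<O> U V) I"
  by (simp_all add: free_sheaf_def map_vec_def fun_eq_iff)

section \<open>Maps from free sheaves given by families of sections\<close>

definition free_sheaf_map :: "('x, 'r, 'm) module_presheaf \<Rightarrow> 'x set \<Rightarrow> 'i set \<Rightarrow> ('i \<Rightarrow> 'm)
      \<Rightarrow> 'x set \<Rightarrow> ('i \<Rightarrow> 'r) \<Rightarrow> 'm" where
  "free_sheaf_map \<G> U I g V = lincomb (sections \<G> V) I (\<lambda>i. restr \<G> U V (g i))"

text \<open>Restricting before or after the map gives two maps semilinear along the restriction of
  rings. By \<open>semilinear_eqI\<close> they need comparing only on unit vectors, where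
  transitivity of restriction suffices.\<close>

lemma free_sheaf_map_hom:
  assumes "sheaf_of_modules X \<O> \<G>" and U: "openin X U" and g: "g ` I \<subseteq> carrier (sections \<G> U)"
  shows "free_sheaf_map \<G> U I g \<in> sheaf_hom (subtopology X U) \<O> (free_sheaf \<O> I) \<G>"
proof -
  interpret G: sheaf_of_modules X \<O> \<G> by fact
  have gV: "(\<lambda>i. restr \<G> U V (g i)) ` I \<subseteq> carrier (sections \<G> V)" if "openin X V" "V \<subseteq> U" for V
    using G.M.restr_closed[OF U that] g by blast
  have hom: "free_sheaf_map \<G> U I g V \<in> module_hom (sections \<O> V) (free_module (sections \<O> V) I) (sections \<G> V)"
    if "openin X V" "V \<subseteq> U" for V
    unfolding free_sheaf_map_def by (rule lincomb_hom[OF G.sections_module[OF that(1)] gV[OF that]])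
  have unit: "free_sheaf_map \<G> U I g V (unit_vec (sections \<O> V) I i) = restr \<G> U V (g i)"
    if "openin X V" "V \<subseteq> U" "i \<in> I" for V i
    unfolding free_sheaf_map_def by (rule lincomb_unit_vec[OF G.sections_module[OF that(1)] gV[OF that(1,2)] that(3)])
  have "free_sheaf_map \<G> U I g W (map_vec (restr \<O> V W) I s) = restr \<G> V W (free_sheaf_map \<G> U I g V s)"
    if V: "openin X V" "V \<subseteq> U" and W: "openin X W" "W \<subseteq> V" and s: "s \<in> carrier (free_module (sections \<O> V) I)"
    for V W s
  proof -
    note r = G.restr_ring_hom[OF V(1) W]
    note cr = G.sections_cring[OF V(1)] G.sections_cring[OF W(1)]
    have WU: "W \<subseteq> U" using V(2) W(2) by blast
    show ?thesis
    proof (rule semilinear_eqI[OF cr(1) _ _ _ _ s, where f = "restr \<O> V W" and N = "sections \<G> W"])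
      show "abelian_group (sections \<G> W)"
        using G.sections_module[OF W(1)] by (simp add: Module.module_def)
      show "(\<lambda>s. free_sheaf_map \<G> U I g W (map_vec (restr \<O> V W) I s))
          \<in> semilinear (sections \<O> V) (restr \<O> V W) (free_module (sections \<O> V) I) (sections \<G> W)"
        using semilinear_comp[OF map_vec_semilinear[OF cr r] hom[OF W(1) WU, unfolded module_hom_eq_semilinear]]
          ring_hom_closed[OF r] by blast
      show "(\<lambda>s. restr \<G> V W (free_sheaf_map \<G> U I g V s))
          \<in> semilinear (sections \<O> V) (restr \<O> V W) (free_module (sections \<O> V) I) (sections \<G> W)"
        using semilinear_comp[OF hom[OF V, unfolded module_hom_eq_semilinear] G.restr_semilinear[OF V(1) W]]
        by auto
      fix i assume i: "i \<in> I"
      then have "g i \<in> carrier (sections \<G> U)" using g by blast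
      then show "free_sheaf_map \<G> U I g W (map_vec (restr \<O> V W) I (unit_vec (sections \<O> V) I i)) =
          restr \<G> V W (free_sheaf_map \<G> U I g V (unit_vec (sections \<O> V) I i))"
        using G.M.restr_comp[OF U V(1) W V(2)]
        by (simp add: map_vec_unit_vec[OF cr r] unit[OF W(1) WU i] unit[OF V i])
    qed
  qed
  then show ?thesis
    using hom openin_open_subtopology[OF U] by (simp add: sheaf_hom_def free_sheaf_simps)
qed

text \<open>The two rows of \<open>base_change_presentation\<close> are the stalks at
  \<open>p\<close> and \<open>q\<close> of a single pair of sheaf maps over \<open>U\<close>, and
  naturality of these maps supplies the commuting squares.\<close>

lemma natural_morphism_iso_iff_exact_on:
  assumes "ringed_finite_space X \<O>" "sheaf_of_modules X \<O> \<M>"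
    and U: "openin X U" and p: "p \<in> U" and pq: "specializes X p q"
    and \<phi>: "\<phi> \<in> sheaf_hom (subtopology X U) \<O> (free_sheaf \<O> I) (free_sheaf \<O> J)"
    and \<psi>: "\<psi> \<in> sheaf_hom (subtopology X U) \<O> (free_sheaf \<O> J) \<M>"
    and exact: "exact_on (free_sheaf \<O> I) (free_sheaf \<O> J) \<M> \<phi> \<psi> (min_open X p)"
  shows "natural_morphism X \<M> p q \<in> module_iso (stalk X \<O> q) (stalk_base_change X \<O> \<M> p q) (stalk X \<M> q)
    \<longleftrightarrow> exact_on (free_sheaf \<O> I) (free_sheaf \<O> J) \<M> \<phi> \<psi> (min_open X q)"
proof -
  interpret X: ringed_finite_space X \<O> by fact
  interpret M: sheaf_of_modules X \<O> \<M> by fact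
  note mo = min_open_is_least[OF X.finite_topspace]
  have pX: "p \<in> topspace X" using openin_subset[OF U] p by blast
  have Up: "openin X (min_open X p)" "min_open X p \<subseteq> U"
    using mo(1)[OF pX] mo(3)[OF pX U p] .
  have qX: "q \<in> topspace X" using pq openin_subset[OF Up(1)] by (auto simp: specializes_def)
  have Uq: "openin X (min_open X q)" "min_open X q \<subseteq> min_open X p"
    using mo(1)[OF qX] mo(3)[OF qX Up(1)] pq by (auto simp: specializes_def)
  have sub: "openin (subtopology X U) (min_open X p)" "openin (subtopology X U) (min_open X q)"
    using Up Uq by (auto simp: openin_open_subtopology[OF U])
  note hom\<phi> = sheaf_homD[OF \<phi>, unfolded free_sheaf_simps] and hom\<psi> = sheaf_homD[OF \<psi>, unfolded free_sheaf_simps]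
  interpret base_change_presentation "stalk X \<O> p" "stalk X \<O> q" "stalk_restr X \<O> p q"
    "stalk X \<M> p" "stalk X \<M> q" "stalk_restr X \<M> p q" I J "\<phi> (min_open X p)" "\<psi> (min_open X p)"
    "\<phi> (min_open X q)" "\<psi> (min_open X q)"
  proof (intro base_change_presentation.intro base_change_map.intro base_change_presentation_axioms.intro,
      unfold stalk_def stalk_restr_def)
    show "Module.module (sections \<O> (min_open X p)) (sections \<M> (min_open X p))"
      "Module.module (sections \<O> (min_open X q)) (sections \<M> (min_open X q))"
      by (intro M.sections_module Up Uq)+
    show "restr \<O> (min_open X p) (min_open X q) \<in>
        ring_hom (sections \<O> (min_open X p)) (sections \<O> (min_open X q))"
      by (rule X.restr_ring_hom[OF Up(1) Uq])
    show "restr \<M> (min_open X p) (min_open X q) \<in> semilinear (sections \<O> (min_open X p))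
        (restr \<O> (min_open X p) (min_open X q)) (sections \<M> (min_open X p)) (sections \<M> (min_open X q))"
      by (rule M.restr_semilinear[OF Up(1) Uq])
  qed (use hom\<phi>(1)[OF sub(1)] hom\<phi>(1)[OF sub(2)] hom\<psi>(1)[OF sub(1)] hom\<psi>(1)[OF sub(2)]
        hom\<phi>(2)[OF sub Uq(2)] hom\<psi>(2)[OF sub Uq(2)] exact in
        \<open>simp_all add: exact_on_def free_sheaf_simps\<close>)
  show ?thesis
    using iso_iff_exact
    by (simp add: natural_morphism_def stalk_base_change_def exact_on_def free_sheaf_simps stalk_def)
qed

theorem theorem2p5:
  fixes X :: "'x topology"
    and \<O> :: "('x, 'r) ring_presheaf"
    and \<M> :: "('x, 'r, 'm) module_presheaf"
  assumes "ringed_finite_space X \<O>"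
    and "sheaf_of_modules X \<O> \<M>"
  shows "quasi_coherent TYPE('i + ('m \<Rightarrow> 'r)) TYPE('j + 'm) X \<O> \<M> \<longleftrightarrow>
    (\<forall>p\<in>topspace X. \<forall>q\<in>topspace X. specializes X p q \<longrightarrow>
       natural_morphism X \<M> p q \<in>
         module_iso (stalk X \<O> q) (stalk_base_change X \<O> \<M> p q) (stalk X \<M> q))"
    (is "?qc \<longleftrightarrow> ?iso")
proof -
  interpret X: ringed_finite_space X \<O> by fact
  interpret M: sheaf_of_modules X \<O> \<M> by fact
  note mo = min_open_is_least[OF X.finite_topspace]
  have stalks: "right_exact_sequence (subtopology X U) \<O> (free_sheaf \<O> I) (free_sheaf \<O> J) \<M> \<phi> \<psi> \<longleftrightarrow>
      (\<forall>q\<in>U. exact_on (free_sheaf \<O> I) (free_sheaf \<O> J) \<M> \<phi> \<psi> (min_open X q))"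
    if U: "openin X U" and "\<phi> \<in> sheaf_hom (subtopology X U) \<O> (free_sheaf \<O> I) (free_sheaf \<O> J)"
      "\<psi> \<in> sheaf_hom (subtopology X U) \<O> (free_sheaf \<O> J) \<M>"
    for U \<phi> \<psi> and I :: "('i + ('m \<Rightarrow> 'r)) set" and J :: "('j + 'm) set"
  proof -
    have fin: "ringed_finite_space (subtopology X U) \<O>"
      by (rule ringed_finite_space_subtopology[OF assms(1) U])
    have top: "topspace (subtopology X U) = U" using openin_subset[OF U] by (simp add: Int_absorb1)
    show ?thesis
      unfolding right_exact_sequence_iff_exact_on_stalks[OF fin free_sheaf_is_sheaf[OF fin]
          free_sheaf_is_sheaf[OF fin] sheaf_of_modules_subtopology[OF assms(2) U] that(2,3)] top
      by (intro ball_cong refl) (simp only: min_open_subtopology[OF U])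
  qed
  show ?thesis
  proof
    assume ?qc
    show ?iso
    proof (intro ballI impI)
      fix p q assume pq: "p \<in> topspace X" "q \<in> topspace X" "specializes X p q"
      from bspec[OF \<open>?qc\<close>[unfolded quasi_coherent_def] pq(1)]
      obtain U I J \<phi> \<psi> where U: "openin X U" "p \<in> U"
        and ex: "right_exact_sequence (subtopology X U) \<O> (free_sheaf \<O> (I :: ('i + ('m \<Rightarrow> 'r)) set))
          (free_sheaf \<O> (J :: ('j + 'm) set)) \<M> \<phi> \<psi>"
        by (elim exE conjE)
      have hom: "\<phi> \<in> sheaf_hom (subtopology X U) \<O> (free_sheaf \<O> I) (free_sheaf \<O> J)"
        "\<psi> \<in> sheaf_hom (subtopology X U) \<O> (free_sheaf \<O> J) \<M>"
        using ex by (simp_all add: right_exact_sequence_def)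
      note exact = ex[unfolded stalks[OF U(1) hom]]
      \<comment> \<open>\<open>U\<close> contains the minimal open set of \<open>p\<close>, so the
        same presentation is exact at \<open>p\<close> and at \<open>q\<close>.\<close>
      have "q \<in> U" using mo(3)[OF pq(1) U] pq(3) by (auto simp: specializes_def)
      then show "natural_morphism X \<M> p q \<in>
          module_iso (stalk X \<O> q) (stalk_base_change X \<O> \<M> p q) (stalk X \<M> q)"
        using natural_morphism_iso_iff_exact_on[OF assms U pq(3) hom bspec[OF exact U(2)]] bspec[OF exact]
        by simp
    qed
  next
    assume iso: ?iso
    show ?qc
      unfolding quasi_coherent_def
    proof (intro ballI)
      fix p assume p: "p \<in> topspace X"
      \<comment> \<open>With the smallest choice of \<open>U\<close>, every \<open>q\<close> in
        \<open>U\<close> satisfies \<open>p \<le> q\<close>, as the hypothesis requires.\<close>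
      define U where "U = min_open X p"
      have U: "openin X U" "p \<in> U" using mo[OF p] by (simp_all add: U_def)
      interpret MU: Module.module "sections \<O> U" "sections \<M> U" by (rule M.sections_module[OF U(1)])
      \<comment> \<open>One generator for each section over \<open>U\<close>, embedded by
        \<open>Inr\<close> to fit the index type.\<close>
      define J :: "('j + 'm) set" where "J = Inr ` carrier (sections \<M> U)"
      define \<psi> where "\<psi> = free_sheaf_map \<M> U J projr"
      define K where "K = {k \<in> carrier (free_module (sections \<O> U) J). \<psi> U k = \<zero>\<^bsub>sections \<M> U\<^esub>}"
      define code :: "('j + 'm \<Rightarrow> 'r) \<Rightarrow> 'i + ('m \<Rightarrow> 'r)" where "code k = Inr (k \<circ> Inr)" for k
        \<comment> \<open>\<open>k\<close> is \<open>undefined\<close> off \<open>J\<close>, so composing with \<open>Inr\<close> keeps all its information; this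
          fits the relations into the index type for \<open>I\<close>.\<close>
      define I where "I = code ` K"
      \<comment> \<open>\<open>inv_into K code\<close> decodes an index to the relation it stands
        for, so the basis vector at \<open>code k\<close> is sent to \<open>k\<close>.\<close>
      define \<phi> where "\<phi> = free_sheaf_map (free_sheaf \<O> J) U I (inv_into K code)"
      have gen: "projr ` J \<subseteq> carrier (sections \<M> U)" by (auto simp: J_def)
      have "inv_into K code ` I \<subseteq> K" by (auto simp: I_def intro: inv_into_into)
      then have rel: "inv_into K code ` I \<subseteq> carrier (sections (free_sheaf \<O> J) U)"
        unfolding free_sheaf_simps by (auto simp: K_def)
      have hom: "\<phi> \<in> sheaf_hom (subtopology X U) \<O> (free_sheaf \<O> I) (free_sheaf \<O> J)"
        "\<psi> \<in> sheaf_hom (subtopology X U) \<O> (free_sheaf \<O> J) \<M>"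
        unfolding \<phi>_def \<psi>_def
        by (intro free_sheaf_map_hom[OF free_sheaf_is_sheaf[OF assms(1)] U(1) rel]
            free_sheaf_map_hom[OF assms(2) U(1) gen])+
      have inj: "inj_on code K"
      proof (rule inj_onI)
        fix k k' assume k: "k \<in> K" "k' \<in> K" "code k = code k'"
        then have "k (Inr x) = k' (Inr x)" for x by (auto simp: code_def fun_eq_iff)
        then show "k = k'"
          using k(1,2) by (intro extensionalityI[of k J]) (auto simp: K_def J_def carrier_free_module PiE_iff)
      qed
      have exact: "exact_on (free_sheaf \<O> I) (free_sheaf \<O> J) \<M> \<phi> \<psi> U"
      proof -
        have sub: "openin (subtopology X U) U" using U(1) by (simp add: openin_open_subtopology)
        note hom\<phi> = sheaf_homD(1)[OF hom(1) sub, unfolded free_sheaf_simps]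
        note hom\<psi> = sheaf_homD(1)[OF hom(2) sub, unfolded free_sheaf_simps]
        note cr = X.sections_cring[OF U(1)]
        have \<psi>_unit: "\<psi> U (unit_vec (sections \<O> U) J (Inr x)) = x" if "x \<in> carrier (sections \<M> U)" for x
        proof -
          have "(\<lambda>i. restr \<M> U U (projr i)) ` J \<subseteq> carrier (sections \<M> U)"
            by (auto simp: J_def M.M.restr_id[OF U(1)])
          from lincomb_unit_vec[OF M.sections_module[OF U(1)] this, of "Inr x"] show ?thesis
            using M.M.restr_id[OF U(1)] that by (simp add: \<psi>_def free_sheaf_map_def J_def)
        qed
        have \<phi>_unit: "\<phi> U (unit_vec (sections \<O> U) I i) = inv_into K code i" if "i \<in> I" for i
        proof -
          interpret F: sheaf_of_modules X \<O> "free_sheaf \<O> J" by (rule free_sheaf_is_sheaf[OF assms(1)])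
          have id: "restr (free_sheaf \<O> J) U U (inv_into K code j) = inv_into K code j" if "j \<in> I" for j
            using F.M.restr_id[OF U(1)] rel that by blast
          show ?thesis
            unfolding \<phi>_def free_sheaf_map_def
            using lincomb_unit_vec[OF F.sections_module[OF U(1)],
                of "\<lambda>i. restr (free_sheaf \<O> J) U U (inv_into K code i)" I i] that rel id
            by (simp add: image_subset_iff)
        qed
        \<comment> \<open>Basis vectors go to relations, so \<open>\<psi> U\<close> kills the whole
          image by linearity; conversely each relation is itself the value at the basis vector
          indexed by its code.\<close>
        have "\<phi> U ` carrier (free_module (sections \<O> U) I) = K"
        proof (intro subset_antisym image_subsetI subsetI)
          fix t assume t: "t \<in> carrier (free_module (sections \<O> U) I)"
          have "\<psi> U (\<phi> U t) = (\<lambda>t. \<zero>\<^bsub>sections \<M> U\<^esub>) t"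
          proof (rule semilinear_eqI[OF cr MU.abelian_group_axioms _ _ _ t, where f = "\<lambda>a. a"])
            show "(\<lambda>t. \<psi> U (\<phi> U t)) \<in> semilinear (sections \<O> U) (\<lambda>a. a)
                (free_module (sections \<O> U) I) (sections \<M> U)"
              using semilinear_comp[OF hom\<phi>[unfolded module_hom_eq_semilinear]
                hom\<psi>[unfolded module_hom_eq_semilinear]] by simp
            show "(\<lambda>t. \<zero>\<^bsub>sections \<M> U\<^esub>) \<in> semilinear (sections \<O> U) (\<lambda>a. a)
                (free_module (sections \<O> U) I) (sections \<M> U)"
              by (simp add: semilinear_def)
            fix i assume i: "i \<in> I"
            then have "inv_into K code i \<in> K" unfolding I_def by (rule inv_into_into)
            then have "\<psi> U (inv_into K code i) = \<zero>\<^bsub>sections \<M> U\<^esub>" by (simp add: K_def)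
            then show "\<psi> U (\<phi> U (unit_vec (sections \<O> U) I i)) = \<zero>\<^bsub>sections \<M> U\<^esub>"
              by (simp only: \<phi>_unit[OF i])
          qed
          then show "\<phi> U t \<in> K" using module_homD(1)[OF hom\<phi> t] by (simp add: K_def)
        next
          fix k assume k: "k \<in> K"
          then have "code k \<in> I" by (simp add: I_def)
          then have "\<phi> U (unit_vec (sections \<O> U) I (code k)) = k"
            by (simp add: \<phi>_unit inv_into_f_f[OF inj k])
          then show "k \<in> \<phi> U ` carrier (free_module (sections \<O> U) I)"
            using unit_vec_closed[OF cr, of I "code k"] by (intro image_eqI) auto
        qed
        moreover have "\<psi> U ` carrier (free_module (sections \<O> U) J) = carrier (sections \<M> U)"
        proof (intro subset_antisym image_subsetI subsetI)
          fix x assume "x \<in> carrier (sections \<M> U)"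
          from \<psi>_unit[OF this, symmetric] unit_vec_closed[OF cr]
          show "x \<in> \<psi> U ` carrier (free_module (sections \<O> U) J)" by (rule image_eqI)
        qed (rule module_homD(1)[OF hom\<psi>])
        ultimately show ?thesis by (simp add: exact_on_def free_sheaf_simps K_def)
      qed
      \<comment> \<open>Exactness at \<open>p\<close> is now available, so the equivalence for the
        pair \<open>p\<close>, \<open>q\<close> is read from the isomorphism to exactness at
        \<open>q\<close>.\<close>
      have "exact_on (free_sheaf \<O> I) (free_sheaf \<O> J) \<M> \<phi> \<psi> (min_open X q)" if "q \<in> U" for q
      proof -
        have q: "q \<in> topspace X" "specializes X p q"
          using openin_subset[OF U(1)] that by (auto simp: specializes_def U_def)
        show ?thesis
          using natural_morphism_iso_iff_exact_on[OF assms U q(2) hom exact[unfolded U_def]] iso p q by simp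
      qed
      then have "right_exact_sequence (subtopology X U) \<O> (free_sheaf \<O> I) (free_sheaf \<O> J) \<M> \<phi> \<psi>"
        using stalks[OF U(1) hom] by simp
      with U show "\<exists>U. openin X U \<and> p \<in> U \<and> (\<exists>(I :: ('i + ('m \<Rightarrow> 'r)) set) (J :: ('j + 'm) set) \<phi> \<psi>.
          right_exact_sequence (subtopology X U) \<O> (free_sheaf \<O> I) (free_sheaf \<O> J) \<M> \<phi> \<psi>)"
        by (intro exI[of _ U] conjI exI[of _ I] exI[of _ J] exI[of _ \<phi>] exI[of _ \<psi>])
    qed
  qed
qed

end
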